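(* The class of topological groups with the fixed-point property for cones is closed under the following operations: (a) taking open subgroups: if $G$ is a topological group with the fixed-point property for cones and $H\le G$ is an open subgroup, then $H$ has the fixed-point property for cones; (b) surjective continuous homomorphisms: if $H$ and $G$ are topological groups, $\phi:H\to G$ is a surjective continuous group homomorphism and $H$ has the fixed-point property for cones, then $G$ has the fixed-point property for cones; (c) extensions by finite groups: if $G$ is a topological group and $F\unlhd G$ is a finite normal subgroup such that $G/F$ has the fixed-point property for cones, then $G$ has the fixed-point property for cones.
   Context: All vector spaces are real and all locally convex topologies are Hausdorff; $E'$ denotes the topological dual of $E$. A cone $C$ in a vector space is a non-empty subset closed under addition and under multiplication by non-negative scalars (hence convex); it is proper if $C\cap(-C)=\{0\}$. Let $C$ be a cone in a locally convex vector space $E$. A representation of a topological group $G$ on $C$ is a linear representation $\pi$ of $G$ on $E$ (each $\pi(g)$ continuous, so that the adjoint $\pi^*(g)\lambda=\lambda\circ\pi(g^{-1})$ acts on $E'$) such that $\pi(g)C\subset C$ for all $g\in G$. - It is locally bounded right-uniformly continuous if there is a non-zero $x_0\in C$ whose orbit is a bounded subset of $E$ (absorbed by every neighborhood of the origin) and such that for every neighborhood $U\subset E$ of the origin there is a neighborhood $V\subset G$ of the identity with $\pi(ag)x_0-\pi(g)x_0\in U$ for all $a\in V$, $g\in G$. - It is of cobounded type if there is $\lambda\in E'$ such that for every $\lambda'\in E'$ there are $g_1,\dots,g_n\in G$ with $\pm\lambda'\le\sum_{j=1}^n\pi^*(g_j)\lambda$, where $\mu\le\nu$ in $E'$ means $\mu(c)\le\nu(c)$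 for all $c\in C$. $G$ has the fixed-point property for cones if every representation of $G$ on a non-empty weakly complete (i.e. complete for the weak topology $\sigma(E,E')$) proper convex cone $C$ in a locally convex vector space $E$ which is locally bounded right-uniformly continuous and of cobounded type has a non-zero fixed point in $C$. Subgroups carry the subspace topology and quotient groups the quotient topology. *)

theory Defs
  imports
    "HOL-Analysis.Analysis"
    "HOL-Algebra.Coset"
    "HOL-Library.Function_Algebras"
begin

section \<open>Topological groups\<close>

definition topological_group :: "'g monoid \<Rightarrow> 'g topology \<Rightarrow> bool" where
  "topological_group G TG \<longleftrightarrow>
     group G \<and> topspace TG = carrier G \<and>
     continuous_map (prod_topology TG TG) TG (\<lambda>(x, y). x \<otimes>\<^bsub>G\<^esub> y) \<and>
     continuous_map TG TG (\<lambda>x. inv\<^bsub>G\<^esub> x)"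

definition quotient_group_topology :: "'g monoid \<Rightarrow> 'g topology \<Rightarrow> 'g set \<Rightarrow> 'g set topology" where
  "quotient_group_topology G TG N =
     topology (\<lambda>U. U \<subseteq> carrier (G Mod N) \<and> openin TG {x \<in> topspace TG. N #>\<^bsub>G\<^esub> x \<in> U})"

lemma openin_quotient_group_topology:
  "openin (quotient_group_topology G TG N) U \<longleftrightarrow>
     U \<subseteq> carrier (G Mod N) \<and> openin TG {x \<in> topspace TG. N #>\<^bsub>G\<^esub> x \<in> U}"
proof -
  let ?P = "\<lambda>U. {x \<in> topspace TG. N #>\<^bsub>G\<^esub> x \<in> U}"
  have "?P (S \<inter> S') = ?P S \<inter> ?P S'" for S S' by auto
  moreover have "?P (\<Union>K) = \<Union>(?P ` K)" for K by auto
  ultimately have "istopology (\<lambda>U. U \<subseteq> carrier (G Mod N) \<and> openin TG (?P U))"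
    unfolding istopology_def by (auto intro!: openin_Union simp del: Collect_mem_eq)
  then show ?thesis
    by (simp add: quotient_group_topology_def topology_inverse')
qed

lemma quotient_map_quotient_group_topology:
  assumes "topological_group G TG"
  shows "quotient_map TG (quotient_group_topology G TG N) (\<lambda>x. N #>\<^bsub>G\<^esub> x)"
proof -
  have carr: "carrier (G Mod N) = (\<lambda>x. N #>\<^bsub>G\<^esub> x) ` topspace TG"
    using assms by (auto simp: FactGroup_def RCOSETS_def topological_group_def)
  then have "{x \<in> topspace TG. N #>\<^bsub>G\<^esub> x \<in> carrier (G Mod N)} = topspace TG"
    by auto
  then have "openin (quotient_group_topology G TG N) (carrier (G Mod N))"
    by (simp add: openin_quotient_group_topology)
  then have "topspace (quotient_group_topology G TG N) = carrier (G Mod N)"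
    by (metis openin_quotient_group_topology openin_subset openin_topspace subset_antisym)
  then show ?thesis
    by (auto simp: quotient_map_def carr openin_quotient_group_topology)
qed


section \<open>Locally convex spaces, duals and weak completeness\<close>

text \<open>
  Function types are real vector spaces under the pointwise operations; the additive structure
  is already in \<^theory>\<open>HOL-Library.Function_Algebras\<close>.
\<close>

instantiation "fun" :: (type, real_vector) real_vector
begin

definition "r *\<^sub>R f = (\<lambda>x. r *\<^sub>R f x)"

instance
  by standard (simp_all add: scaleR_fun_def fun_eq_iff algebra_simps)

end

text \<open>
  A vector space is represented by a linear subspace \<open>topspace T\<close> of an ambient real vector
  space type \<open>'e\<close>, its topology by \<open>T\<close>. No topology on \<open>'e\<close> itself is involved, and maps are
  only constrained on \<open>topspace T\<close>.
\<close>

definition linear_map_on :: "'e::real_vector set \<Rightarrow> ('e \<Rightarrow> 'f::real_vector) \<Rightarrow> bool" where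
  "linear_map_on E f \<longleftrightarrow>
     (\<forall>x\<in>E. \<forall>y\<in>E. f (x + y) = f x + f y) \<and> (\<forall>r. \<forall>x\<in>E. f (r *\<^sub>R x) = r *\<^sub>R f x)"

definition locally_convex_space :: "'e::real_vector topology \<Rightarrow> bool" where
  "locally_convex_space T \<longleftrightarrow>
     subspace (topspace T) \<and> Hausdorff_space T \<and>
     continuous_map (prod_topology T T) T (\<lambda>(x, y). x + y) \<and>
     continuous_map (prod_topology euclideanreal T) T (\<lambda>(r, x). r *\<^sub>R x) \<and>
     (\<forall>U. openin T U \<and> 0 \<in> U \<longrightarrow> (\<exists>V. openin T V \<and> 0 \<in> V \<and> convex V \<and> V \<subseteq> U))"

definition topological_dual :: "'e::real_vector topology \<Rightarrow> ('e \<Rightarrow> real) set" where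
  "topological_dual T =
     {\<mu>. linear_map_on (topspace T) \<mu> \<and> continuous_map T euclideanreal \<mu>}"

definition weak_topology :: "'e::real_vector topology \<Rightarrow> 'e topology" where
  "weak_topology T =
     topology_generated_by
       {{x \<in> topspace T. \<mu> x \<in> U} |\<mu> U. \<mu> \<in> topological_dual T \<and> open U}"

text \<open>
  Completeness refers to the translation-invariant uniformity of the vector space topology and
  is stated with Cauchy filters (equivalently, Cauchy nets; sequences would not suffice).
\<close>

definition complete_subset :: "'e::real_vector topology \<Rightarrow> 'e set \<Rightarrow> bool" where
  "complete_subset T C \<longleftrightarrow>
     (\<forall>F. F \<noteq> bot \<and> F \<le> principal C \<and>
          (\<forall>U. openin T U \<and> 0 \<in> U \<longrightarrow> (\<forall>\<^sub>F (x, y) in F \<times>\<^sub>F F. x - y \<in> U)) \<longrightarrow>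
          (\<exists>c\<in>C. limitin T (\<lambda>x. x) c F))"

definition weakly_complete :: "'e::real_vector topology \<Rightarrow> 'e set \<Rightarrow> bool" where
  "weakly_complete T C \<longleftrightarrow> complete_subset (weak_topology T) C"

definition bounded_subset :: "'e::real_vector topology \<Rightarrow> 'e set \<Rightarrow> bool" where
  "bounded_subset T B \<longleftrightarrow>
     B \<subseteq> topspace T \<and>
     (\<forall>U. openin T U \<and> 0 \<in> U \<longrightarrow> (\<exists>r>0. \<forall>t. \<bar>t\<bar> \<ge> r \<longrightarrow> B \<subseteq> (\<lambda>x. t *\<^sub>R x) ` U))"


section \<open>Representations on cones\<close>

definition proper_cone :: "'e::real_vector set \<Rightarrow> bool" where
  "proper_cone C \<longleftrightarrow> convex_cone C \<and> C \<inter> uminus ` C = {0}"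

definition cone_representation ::
  "'g monoid \<Rightarrow> 'e::real_vector topology \<Rightarrow> 'e set \<Rightarrow> ('g \<Rightarrow> 'e \<Rightarrow> 'e) \<Rightarrow> bool" where
  "cone_representation G T C \<pi> \<longleftrightarrow>
     (\<forall>g\<in>carrier G. linear_map_on (topspace T) (\<pi> g) \<and> continuous_map T T (\<pi> g)) \<and>
     (\<forall>x\<in>topspace T. \<pi> \<one>\<^bsub>G\<^esub> x = x) \<and>
     (\<forall>g\<in>carrier G. \<forall>h\<in>carrier G. \<forall>x\<in>topspace T. \<pi> (g \<otimes>\<^bsub>G\<^esub> h) x = \<pi> g (\<pi> h x)) \<and>
     (\<forall>g\<in>carrier G. \<pi> g ` C \<subseteq> C)"

definition locally_bounded_right_uniformly_continuous ::
  "'g monoid \<Rightarrow> 'g topology \<Rightarrow> 'e::real_vector topology \<Rightarrow> 'e set \<Rightarrow> ('g \<Rightarrow> 'e \<Rightarrow> 'e) \<Rightarrow> bool" where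
  "locally_bounded_right_uniformly_continuous G TG T C \<pi> \<longleftrightarrow>
     (\<exists>x\<^sub>0\<in>C. x\<^sub>0 \<noteq> 0 \<and> bounded_subset T ((\<lambda>g. \<pi> g x\<^sub>0) ` carrier G) \<and>
        (\<forall>U. openin T U \<and> 0 \<in> U \<longrightarrow>
           (\<exists>V. openin TG V \<and> \<one>\<^bsub>G\<^esub> \<in> V \<and>
              (\<forall>a\<in>V. \<forall>g\<in>carrier G. \<pi> (a \<otimes>\<^bsub>G\<^esub> g) x\<^sub>0 - \<pi> g x\<^sub>0 \<in> U))))"

definition adjoint_rep ::
  "'g monoid \<Rightarrow> ('g \<Rightarrow> 'e \<Rightarrow> 'e) \<Rightarrow> 'g \<Rightarrow> ('e \<Rightarrow> real) \<Rightarrow> 'e \<Rightarrow> real" where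
  "adjoint_rep G \<pi> g \<mu> = (\<lambda>x. \<mu> (\<pi> (inv\<^bsub>G\<^esub> g) x))"

definition dual_le :: "'e set \<Rightarrow> ('e \<Rightarrow> real) \<Rightarrow> ('e \<Rightarrow> real) \<Rightarrow> bool" where
  "dual_le C \<mu> \<nu> \<longleftrightarrow> (\<forall>c\<in>C. \<mu> c \<le> \<nu> c)"

definition cobounded_type ::
  "'g monoid \<Rightarrow> 'e::real_vector topology \<Rightarrow> 'e set \<Rightarrow> ('g \<Rightarrow> 'e \<Rightarrow> 'e) \<Rightarrow> bool" where
  "cobounded_type G T C \<pi> \<longleftrightarrow>
     (\<exists>\<mu>\<in>topological_dual T. \<forall>\<nu>\<in>topological_dual T.
        \<exists>(n::nat) g. (\<forall>j\<in>{1..n}. g j \<in> carrier G) \<and>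
          dual_le C \<nu> (\<lambda>x. \<Sum>j=1..n. adjoint_rep G \<pi> (g j) \<mu> x) \<and>
          dual_le C (\<lambda>x. - \<nu> x) (\<lambda>x. \<Sum>j=1..n. adjoint_rep G \<pi> (g j) \<mu> x))"

text \<open>
  HOL cannot quantify over types inside a formula, so the property carries a type argument
  \<open>'e\<close> and ranges over all locally convex spaces whose underlying vector space is a linear subspace
  of \<open>'e\<close> (up to isomorphism: has dimension at most that of \<open>'e\<close>). The property for all locally
  convex spaces is the property for every \<open>'e\<close>.
\<close>

definition fixed_point_property_for_cones ::
  "'e::real_vector itself \<Rightarrow> 'g monoid \<Rightarrow> 'g topology \<Rightarrow> bool" where
  "fixed_point_property_for_cones ambient G TG \<longleftrightarrow>
     (\<forall>(T :: 'e topology) C \<pi>.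
        locally_convex_space T \<and> C \<subseteq> topspace T \<and> proper_cone C \<and> weakly_complete T C \<and>
        cone_representation G T C \<pi> \<and>
        locally_bounded_right_uniformly_continuous G TG T C \<pi> \<and>
        cobounded_type G T C \<pi> \<longrightarrow>
        (\<exists>x\<in>C. x \<noteq> 0 \<and> (\<forall>g\<in>carrier G. \<pi> g x = x)))"

end

theory Submission
  imports Defs
begin

text \<open>
  Each closure property turns a representation of one group into a representation of the other
  that satisfies the same three hypotheses and whose non-zero fixed points give non-zero fixed
  points of the original one. For a surjection \<open>\<phi>\<close> one pulls back along \<open>\<phi>\<close>. For a finite normal
  subgroup \<open>F\<close> one passes to the \<open>F\<close>-fixed vectors; averaging over \<open>F\<close> is a continuous projection
  onto them, so every functional on them extends, and it does not kill non-zero vectors of the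
  proper cone. For an open subgroup \<open>H\<close> one induces: \<open>G\<close> acts on the \<open>H\<close>-equivariant functions
  \<open>G \<rightarrow> E\<close>, a product of copies of \<open>E\<close> indexed by \<open>G/H\<close>. The vector \<open>x\<^sub>0\<close> is placed on the coset \<open>H\<close>,
  which is uniformly continuous because \<open>H\<close> is open, and the dual of a product is the direct sum of
  the duals, which gives the cobounded type.
\<close>

text \<open>Weak completeness and cobounded type speak about all continuous functionals, so each
  transfer depends on expressing functionals on the new space through functionals on the old one. On
  the fixed vectors the extension is explicit, by composing with the average; on the induced space
  only the values at finitely many coset representatives count. Uniqueness of weak limits is not at
  hand, so a limit cannot be shown to be \<open>F\<close>-fixed or equivariant merely because the
  approximating vectors are. It is replaced by a corrected limit with the same test values: the
  average of the limit in one case, a function rebuilt from its values at coset representatives in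
  the other. In the induced representation an element \<open>a\<close> acts on the coordinate at
  \<open>s\<close> through \<open>inv s \<otimes> a \<otimes> s\<close>. This conjugate has no
  uniform control in \<open>s\<close>, but the product topology only looks at finitely many
  coordinates at a time. A fixed function is constant on \<open>G\<close>, and its value is the
  fixed vector of \<open>H\<close>.\<close>

section \<open>Locally convex spaces\<close>

lemma linear_map_on_0: "linear_map_on E f \<Longrightarrow> subspace E \<Longrightarrow> f 0 = 0"
  unfolding linear_map_on_def by (metis scaleR_zero_left subspace_0)

lemma linear_map_on_add: "linear_map_on E f \<Longrightarrow> x \<in> E \<Longrightarrow> y \<in> E \<Longrightarrow> f (x + y) = f x + f y"
  by (simp add: linear_map_on_def)

lemma linear_map_on_scaleR: "linear_map_on E f \<Longrightarrow> x \<in> E \<Longrightarrow> f (r *\<^sub>R x) = r *\<^sub>R f x"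
  by (simp add: linear_map_on_def)

lemma linear_map_on_diff:
  assumes "linear_map_on E f" "subspace E" "x \<in> E" "y \<in> E"
  shows "f (x - y) = f x - f y"
proof -
  have "f (- y) = - f y"
    using linear_map_on_scaleR[OF assms(1,4), of "-1"] by simp
  then show ?thesis
    using linear_map_on_add[OF assms(1,3) subspace_neg[OF assms(2,4)]] by simp
qed

lemma linear_map_on_sum:
  assumes "linear_map_on E f" "subspace E" "\<And>i. i \<in> I \<Longrightarrow> x i \<in> E"
  shows "f (\<Sum>i\<in>I. x i) = (\<Sum>i\<in>I. f (x i))"
  using assms(3)
proof (induction I rule: infinite_finite_induct)
  case (insert i I)
  then show ?case
    using assms by (simp add: linear_map_on_add[OF assms(1)] subspace_sum)
qed (use assms linear_map_on_0 in auto)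

lemma lcs_subspace: "locally_convex_space T \<Longrightarrow> subspace (topspace T)"
  by (simp add: locally_convex_space_def)

lemma lcs_add_mem:
  "locally_convex_space T \<Longrightarrow> x \<in> topspace T \<Longrightarrow> y \<in> topspace T \<Longrightarrow> x + y \<in> topspace T"
  by (meson lcs_subspace subspace_add)

lemma lcs_diff_mem:
  "locally_convex_space T \<Longrightarrow> x \<in> topspace T \<Longrightarrow> y \<in> topspace T \<Longrightarrow> x - y \<in> topspace T"
  by (meson lcs_subspace subspace_diff)

lemma lcs_scaleR_mem: "locally_convex_space T \<Longrightarrow> x \<in> topspace T \<Longrightarrow> r *\<^sub>R x \<in> topspace T"
  by (meson lcs_subspace subspace_scale)

lemma lcs_zero_mem: "locally_convex_space T \<Longrightarrow> 0 \<in> topspace T"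
  by (meson lcs_subspace subspace_0)

lemma lcs_sum_mem:
  "locally_convex_space T \<Longrightarrow> (\<And>i. i \<in> I \<Longrightarrow> x i \<in> topspace T) \<Longrightarrow> (\<Sum>i\<in>I. x i) \<in> topspace T"
  by (meson lcs_subspace subspace_sum)

lemma continuous_map_lcs_add:
  assumes "locally_convex_space T" "continuous_map X T f" "continuous_map X T g"
  shows "continuous_map X T (\<lambda>x. f x + g x)"
proof -
  have "continuous_map (prod_topology T T) T (\<lambda>(x, y). x + y)"
    using assms by (simp add: locally_convex_space_def)
  from continuous_map_compose[OF _ this, of X "\<lambda>x. (f x, g x)"] show ?thesis
    using assms by (simp add: continuous_map_paired o_def)
qed

lemma continuous_map_lcs_scaleR_pair:
  assumes "locally_convex_space T" "continuous_map X euclideanreal r" "continuous_map X T f"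
  shows "continuous_map X T (\<lambda>x. r x *\<^sub>R f x)"
proof -
  have "continuous_map (prod_topology euclideanreal T) T (\<lambda>(x, y). x *\<^sub>R y)"
    using assms by (simp add: locally_convex_space_def)
  from continuous_map_compose[OF _ this, of X "\<lambda>x. (r x, f x)"] show ?thesis
    using assms by (simp add: continuous_map_paired o_def)
qed

lemma continuous_map_lcs_sum:
  assumes "locally_convex_space T" "\<And>i. i \<in> I \<Longrightarrow> continuous_map X T (f i)"
  shows "continuous_map X T (\<lambda>x. \<Sum>i\<in>I. f i x)"
  using assms(2)
proof (induction I rule: infinite_finite_induct)
  case (insert i I)
  then show ?case
    using assms by (simp add: continuous_map_lcs_add)
qed (use lcs_zero_mem[OF assms(1)] in auto)

lemma locally_convex_space_subtopology:
  assumes T: "locally_convex_space T" and S: "subspace S" "S \<subseteq> topspace T"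
  shows "locally_convex_space (subtopology T S)"
proof -
  have tS: "topspace (subtopology T S) = S"
    using S by (auto simp: topspace_subtopology)
  have fs: "continuous_map (prod_topology (subtopology T S) (subtopology T S)) T fst"
    "continuous_map (prod_topology (subtopology T S) (subtopology T S)) T snd"
    "continuous_map (prod_topology euclideanreal (subtopology T S)) T snd"
    "continuous_map (prod_topology euclideanreal (subtopology T S)) euclideanreal fst"
    by (rule continuous_map_into_fulltopology[OF continuous_map_fst]
        continuous_map_into_fulltopology[OF continuous_map_snd] continuous_map_fst)+
  have "continuous_map (prod_topology (subtopology T S) (subtopology T S)) (subtopology T S)
      (\<lambda>(x, y). x + y)"
    using continuous_map_lcs_add[OF T fs(1,2)] S
    by (auto simp: continuous_map_in_subtopology case_prod_unfold tS intro: subspace_add)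
  moreover have "continuous_map (prod_topology euclideanreal (subtopology T S)) (subtopology T S)
      (\<lambda>(x, y). x *\<^sub>R y)"
    using continuous_map_lcs_scaleR_pair[OF T fs(4,3)] S
    by (auto simp: continuous_map_in_subtopology case_prod_unfold tS intro: subspace_scale)
  moreover have "\<exists>V. openin (subtopology T S) V \<and> 0 \<in> V \<and> convex V \<and> V \<subseteq> U"
    if U: "openin (subtopology T S) U" "0 \<in> U" for U
  proof -
    obtain U' where U': "openin T U'" "U = U' \<inter> S"
      using U(1) by (auto simp: openin_subtopology)
    then obtain V where "openin T V" "0 \<in> V" "convex V" "V \<subseteq> U'"
      using T U(2) unfolding locally_convex_space_def by blast
    then show ?thesis
      using U' S subspace_0[OF S(1)] convex_Int[OF _ subspace_imp_convex[OF S(1)], of V]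
      by (intro exI[of _ "V \<inter> S"]) (auto simp: openin_subtopology)
  qed
  ultimately show ?thesis
    using T S unfolding locally_convex_space_def by (simp add: tS Hausdorff_space_subtopology del: topspace_subtopology)
qed

text \<open>A basic open box restricts only finitely many coordinates, and the finitely many
  restrictions can be replaced by one common \<open>U\<close>. Convexity of \<open>U\<close> gives
  local convexity of the product; finiteness of \<open>S\<close> later makes functionals depend on
  finitely many cosets.\<close>

lemma product_topology_zero_neighbourhood:
  assumes "openin (product_topology (\<lambda>_::'i. T) UNIV) W" "0 \<in> W"
    and T: "locally_convex_space (T :: 'e::real_vector topology)"
  obtains S U where "finite S" "openin T U" "0 \<in> U" "convex U"
    "\<And>f. (\<And>i. f i \<in> topspace T) \<Longrightarrow> (\<And>i. i \<in> S \<Longrightarrow> f i \<in> U) \<Longrightarrow> f \<in> W"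
proof -
  obtain X where X: "0 \<in> (\<Pi>\<^sub>E i\<in>UNIV. X i)" "\<And>i. openin T (X i)"
      "finite {i. X i \<noteq> topspace T}" "(\<Pi>\<^sub>E i\<in>UNIV. X i) \<subseteq> W"
    using product_topology_open_contains_basis[OF assms(1,2)] by blast
  define S where "S = {i. X i \<noteq> topspace T}"
  \<comment> \<open>For empty \<open>S\<close> the intersection is \<open>UNIV\<close>; the factor
    \<open>topspace T\<close> keeps \<open>U'\<close> open in that case too.\<close>
  define U' where "U' = topspace T \<inter> \<Inter>(X ` S)"
  have "openin T (topspace T \<inter> \<Inter>(X ` S))"
    using X(2,3) unfolding S_def[symmetric]
    by (cases "S = {}") (auto intro!: openin_Int openin_Inter)
  moreover have "0 \<in> U'"
    using X(1) lcs_zero_mem[OF T] by (auto simp: U'_def PiE_iff)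
  ultimately obtain U where U: "openin T U" "0 \<in> U" "convex U" "U \<subseteq> U'"
    using T unfolding locally_convex_space_def U'_def by blast
  show ?thesis
  proof (rule that[of S U])
    fix f :: "'i \<Rightarrow> 'e" assume f: "\<And>i. f i \<in> topspace T" "\<And>i. i \<in> S \<Longrightarrow> f i \<in> U"
    have "f i \<in> X i" for i
      using f[of i] U(4) by (cases "i \<in> S") (auto simp: S_def U'_def)
    then show "f \<in> W"
      using X(4) by (auto simp: PiE_iff)
  qed (use U X(3) in \<open>auto simp: S_def\<close>)
qed

lemma locally_convex_space_product:
  assumes T: "locally_convex_space (T :: 'e::real_vector topology)"
  shows "locally_convex_space (product_topology (\<lambda>_::'i. T) UNIV)" (is "locally_convex_space ?P")
proof -
  have ts: "topspace ?P = {f. \<forall>i. f i \<in> topspace T}"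
    by (auto simp: PiE_iff)
  have pr: "continuous_map ?P T (\<lambda>f. f i)" for i
    by (rule continuous_map_product_projection) simp
  have fs: "continuous_map (prod_topology ?P ?P) T (\<lambda>x. fst x i)"
    "continuous_map (prod_topology ?P ?P) T (\<lambda>x. snd x i)"
    "continuous_map (prod_topology euclideanreal ?P) T (\<lambda>x. snd x i)" for i
    by (rule continuous_map_compose[OF continuous_map_fst pr, unfolded o_def]
        continuous_map_compose[OF continuous_map_snd pr, unfolded o_def])+
  have "subspace (topspace ?P)"
    unfolding ts using T
    by (auto simp: subspace_def lcs_zero_mem lcs_add_mem lcs_scaleR_mem scaleR_fun_def)
  moreover have "Hausdorff_space ?P"
    using T by (auto simp: Hausdorff_space_product_topology locally_convex_space_def)
  moreover have "continuous_map (prod_topology ?P ?P) ?P (\<lambda>(x, y). x + y)"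
    using continuous_map_lcs_add[OF T fs(1,2)]
    by (simp add: continuous_map_componentwise_UNIV case_prod_unfold)
  moreover have "continuous_map (prod_topology euclideanreal ?P) ?P (\<lambda>(x, y). x *\<^sub>R y)"
    using continuous_map_lcs_scaleR_pair[OF T continuous_map_fst fs(3)]
    by (simp add: continuous_map_componentwise_UNIV case_prod_unfold scaleR_fun_def)
  moreover have "\<exists>V. openin ?P V \<and> 0 \<in> V \<and> convex V \<and> V \<subseteq> W" if W0: "openin ?P W" "0 \<in> W" for W
  proof -
    obtain S U where S: "finite S" "openin T U" "0 \<in> U" "convex U"
      and W: "\<And>f. (\<And>i. f i \<in> topspace T) \<Longrightarrow> (\<And>i. i \<in> S \<Longrightarrow> f i \<in> U) \<Longrightarrow> f \<in> W"
      by (rule product_topology_zero_neighbourhood[OF W0 T]) blast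
    define V where "V = (\<Pi>\<^sub>E i\<in>UNIV. if i \<in> S then U else topspace T)"
    have "openin ?P V"
      unfolding V_def using S
      by (intro product_topology_basis) (auto elim: finite_subset[rotated] split: if_splits)
    moreover have "convex V"
    proof -
      have "convex (if i \<in> S then U else topspace T)" for i
        using S(4) subspace_imp_convex[OF lcs_subspace[OF T]] by simp
      then show ?thesis
        unfolding V_def convex_def[of "PiE _ _"]
        by (auto simp only: PiE_UNIV_domain Pi_iff plus_fun_apply scaleR_fun_def intro!: convexD)
    qed
    moreover have "V \<subseteq> W"
    proof
      fix f assume "f \<in> V"
      then have "f i \<in> (if i \<in> S then U else topspace T)" for i
        by (auto simp: V_def PiE_iff)
      then show "f \<in> W"
        using openin_subset[OF S(2)] by (intro W) (metis subsetD)+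
    qed
    ultimately show ?thesis
      using S(3) lcs_zero_mem[OF T] by (intro exI[of _ V]) (auto simp: V_def PiE_iff)
  qed
  ultimately show ?thesis
    unfolding locally_convex_space_def by blast
qed

text \<open>The main link between the duals of different spaces: it is applied to averaging, to
  evaluation at a point and to the embedding of one coordinate.\<close>

lemma topological_dual_compose:
  assumes "\<mu> \<in> topological_dual T'" "linear_map_on (topspace T) A" "continuous_map T T' A"
  shows "(\<lambda>x. \<mu> (A x)) \<in> topological_dual T"
proof -
  have "A x \<in> topspace T'" if "x \<in> topspace T" for x
    using assms(3) that by (auto simp: continuous_map_def)
  then have "linear_map_on (topspace T) (\<lambda>x. \<mu> (A x))"
    using assms by (auto simp: topological_dual_def linear_map_on_def)
  moreover have "continuous_map T euclideanreal (\<lambda>x. \<mu> (A x))"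
    using continuous_map_compose[OF assms(3), of euclideanreal \<mu>] assms(1)
    by (simp add: topological_dual_def o_def)
  ultimately show ?thesis
    by (simp add: topological_dual_def)
qed

text \<open>The preimage of a neighbourhood absorbs \<open>B\<close>, and linearity carries the
  absorption through \<open>A\<close>. This bounds the averaged orbit.\<close>

lemma bounded_subset_linear_image:
  assumes B: "bounded_subset T B" and T: "locally_convex_space T" "locally_convex_space T'"
    and A: "linear_map_on (topspace T) A" "continuous_map T T' A"
  shows "bounded_subset T' (A ` B)"
  unfolding bounded_subset_def
proof (intro conjI allI impI)
  show "A ` B \<subseteq> topspace T'"
    using A(2) B by (auto simp: continuous_map_def bounded_subset_def)
next
  fix U assume U: "openin T' U \<and> 0 \<in> U"
  let ?U = "{x \<in> topspace T. A x \<in> U}"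
  have "openin T ?U" "0 \<in> ?U"
    using U A T linear_map_on_0[OF A(1)] lcs_subspace lcs_zero_mem
    by (auto intro: openin_continuous_map_preimage)
  then obtain r where r: "r > 0" "\<And>t. \<bar>t\<bar> \<ge> r \<Longrightarrow> B \<subseteq> (\<lambda>x. t *\<^sub>R x) ` ?U"
    using B unfolding bounded_subset_def by meson
  have "A ` B \<subseteq> (\<lambda>x. t *\<^sub>R x) ` U" if t: "\<bar>t\<bar> \<ge> r" for t
  proof
    fix y assume "y \<in> A ` B"
    then obtain x where "x \<in> ?U" "y = A (t *\<^sub>R x)"
      using subsetD[OF r(2)[OF t]] by blast
    then show "y \<in> (\<lambda>x. t *\<^sub>R x) ` U"
      by (auto simp: linear_map_on_scaleR[OF A(1)])
  qed
  then show "\<exists>r>0. \<forall>t. \<bar>t\<bar> \<ge> r \<longrightarrow> A ` B \<subseteq> (\<lambda>x. t *\<^sub>R x) ` U"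
    using r(1) by blast
qed


section \<open>Weak completeness\<close>

text \<open>The zero functional contributes the whole space as a generating set.\<close>

lemma topspace_weak_topology [simp]: "topspace (weak_topology T) = topspace T"
proof -
  have "(\<lambda>_. 0) \<in> topological_dual T"
    by (simp add: topological_dual_def linear_map_on_def)
  then have "\<exists>\<mu> U. topspace T = {x \<in> topspace T. \<mu> x \<in> U} \<and> \<mu> \<in> topological_dual T \<and> open U"
    by (intro exI[of _ "\<lambda>_. 0"] exI[of _ UNIV]) simp
  then show ?thesis
    unfolding weak_topology_def topology_generated_by_topspace by blast
qed

lemma openin_weak_topology_basis:
  "\<mu> \<in> topological_dual T \<Longrightarrow> open U \<Longrightarrow> openin (weak_topology T) {x \<in> topspace T. \<mu> x \<in> U}"
  unfolding weak_topology_def by (rule topology_generated_by_Basis) blast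

text \<open>Convergence is tested on the generating sets; the induction over the generated topology
  carries it to finite intersections and unions.\<close>

lemma limitin_weak_topology_iff:
  assumes "eventually (\<lambda>x. f x \<in> topspace T) F"
  shows "limitin (weak_topology T) f l F \<longleftrightarrow>
    l \<in> topspace T \<and> (\<forall>\<mu>\<in>topological_dual T. ((\<lambda>x. \<mu> (f x)) \<longlongrightarrow> \<mu> l) F)"
proof safe
  assume l: "limitin (weak_topology T) f l F"
  then show lT: "l \<in> topspace T"
    using limitin_topspace by fastforce
  fix \<mu> assume \<mu>: "\<mu> \<in> topological_dual T"
  show "((\<lambda>x. \<mu> (f x)) \<longlongrightarrow> \<mu> l) F"
  proof (rule topological_tendstoI)
    fix U assume "open U" "\<mu> l \<in> U"
    then have "\<forall>\<^sub>F x in F. f x \<in> {x \<in> topspace T. \<mu> x \<in> U}"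
      using l lT openin_weak_topology_basis[OF \<mu>] unfolding limitin_def by blast
    then show "\<forall>\<^sub>F x in F. \<mu> (f x) \<in> U"
      by (rule eventually_mono) simp
  qed
next
  assume lT: "l \<in> topspace T" and l: "\<forall>\<mu>\<in>topological_dual T. ((\<lambda>x. \<mu> (f x)) \<longlongrightarrow> \<mu> l) F"
  have "\<forall>\<^sub>F x in F. f x \<in> U" if "openin (weak_topology T) U" "l \<in> U" for U
    using openin_topology_generated_by[OF that(1)[unfolded weak_topology_def]] that(2)
  proof induction
    case (Basis s)
    then obtain \<mu> U where s: "s = {x \<in> topspace T. \<mu> x \<in> U}" "\<mu> \<in> topological_dual T" "open U"
      by blast
    then have "\<forall>\<^sub>F x in F. \<mu> (f x) \<in> U"
      using l Basis.prems by (auto dest: topological_tendstoD)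
    with assms show ?case
      unfolding s(1) by eventually_elim simp
  next
    case (UN K)
    then obtain k where "k \<in> K" "\<forall>\<^sub>F x in F. f x \<in> k"
      by auto
    from this(2) show ?case
      by (rule eventually_mono) (use \<open>k \<in> K\<close> in auto)
  qed (auto intro: eventually_conj)
  then show "limitin (weak_topology T) f l F"
    using lT by (simp add: limitin_def)
qed

text \<open>From left to right, neighbourhoods cut out by a single functional make its image filter
  Cauchy, and the reals are complete. From right to left, the Cauchy condition is checked on
  generating sets and propagated by induction.\<close>

lemma weakly_Cauchy_iff:
  assumes T: "locally_convex_space T" and F: "F \<noteq> bot" "F \<le> principal (topspace T)"
  shows "(\<forall>U. openin (weak_topology T) U \<and> 0 \<in> U \<longrightarrow> (\<forall>\<^sub>F (x, y) in F \<times>\<^sub>F F. x - y \<in> U)) \<longleftrightarrow>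
    (\<forall>\<mu>\<in>topological_dual T. \<exists>l. (\<mu> \<longlongrightarrow> l) F)"
proof safe
  fix \<mu>
  assume C: "\<forall>U. openin (weak_topology T) U \<and> 0 \<in> U \<longrightarrow> (\<forall>\<^sub>F (x, y) in F \<times>\<^sub>F F. x - y \<in> U)"
    and \<mu>: "\<mu> \<in> topological_dual T"
  then have lin: "linear_map_on (topspace T) \<mu>"
    by (simp add: topological_dual_def)
  have "cauchy_filter (filtermap \<mu> F)"
    unfolding cauchy_filter_metric_filtermap
  proof (intro allI impI)
    fix e :: real assume "e > 0"
    then have "0 \<in> {x \<in> topspace T. \<mu> x \<in> ball 0 e}"
      using T lin by (simp add: lcs_zero_mem linear_map_on_0 lcs_subspace)
    then have "\<forall>\<^sub>F (x, y) in F \<times>\<^sub>F F. x - y \<in> {x \<in> topspace T. \<mu> x \<in> ball 0 e}"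
      using C openin_weak_topology_basis[OF \<mu> open_ball] by blast
    then obtain Q where Q: "eventually Q F"
        "\<And>x y. Q x \<Longrightarrow> Q y \<Longrightarrow> x - y \<in> {x \<in> topspace T. \<mu> x \<in> ball 0 e}"
      by (auto simp: eventually_prod_same)
    have "dist (\<mu> x) (\<mu> y) < e" if "Q x \<and> x \<in> topspace T" "Q y \<and> y \<in> topspace T" for x y
      using that Q(2)[of x y] linear_map_on_diff[OF lin lcs_subspace[OF T]]
      by (simp add: dist_real_def)
    moreover have "\<forall>\<^sub>F x in F. Q x \<and> x \<in> topspace T"
      using Q(1) F(2) by (simp add: eventually_conj le_principal)
    ultimately show "\<exists>P. eventually P F \<and> (\<forall>x y. P x \<and> P y \<longrightarrow> dist (\<mu> x) (\<mu> y) < e)"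
      by blast
  qed
  moreover have "filtermap \<mu> F \<noteq> bot"
    using F(1) by (simp add: filtermap_bot_iff)
  ultimately obtain l where "filtermap \<mu> F \<le> nhds l"
    using complete_UNIV[where 'a = real] unfolding complete_uniform by (metis UNIV_I principal_UNIV top_greatest)
  then show "\<exists>l. (\<mu> \<longlongrightarrow> l) F"
    unfolding filterlim_def by blast
next
  fix U assume conv: "\<forall>\<mu>\<in>topological_dual T. \<exists>l. (\<mu> \<longlongrightarrow> l) F"
    and "openin (weak_topology T) U" "0 \<in> U"
  have evT: "\<forall>\<^sub>F z in F \<times>\<^sub>F F. fst z \<in> topspace T \<and> snd z \<in> topspace T"
    using F(2) by (auto simp: eventually_prod_same le_principal)
  show "\<forall>\<^sub>F (x, y) in F \<times>\<^sub>F F. x - y \<in> U"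
    using openin_topology_generated_by[OF \<open>openin (weak_topology T) U\<close>[unfolded weak_topology_def]]
      \<open>0 \<in> U\<close>
  proof induction
    case (Int a b)
    then have "\<forall>\<^sub>F (x, y) in F \<times>\<^sub>F F. x - y \<in> a" "\<forall>\<^sub>F (x, y) in F \<times>\<^sub>F F. x - y \<in> b"
      by auto
    then show ?case
      by eventually_elim auto
  next
    case (UN K)
    then obtain k where "k \<in> K" "\<forall>\<^sub>F (x, y) in F \<times>\<^sub>F F. x - y \<in> k"
      by auto
    from this(2) show ?case
      by (rule eventually_mono) (use \<open>k \<in> K\<close> in auto)
  next
    case (Basis s)
    then obtain \<mu> V where s: "s = {x \<in> topspace T. \<mu> x \<in> V}" "\<mu> \<in> topological_dual T" "open V"
      by blast
    then have lin: "linear_map_on (topspace T) \<mu>"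
      by (simp add: topological_dual_def)
    obtain l where l: "(\<mu> \<longlongrightarrow> l) F"
      using conv s(2) by blast
    \<comment> \<open>Both factors of the product filter have the same limit \<open>l\<close>, so
      the difference tends to \<open>0\<close>, the value of \<open>\<mu>\<close> at the origin, and
      this value lies in \<open>V\<close>.\<close>
    have "((\<lambda>z. \<mu> (fst z) - \<mu> (snd z)) \<longlongrightarrow> l - l) (F \<times>\<^sub>F F)"
      by (intro tendsto_diff filterlim_compose[OF l] filterlim_fst filterlim_snd)
    moreover have "l - l \<in> V"
      using Basis.prems s(1) T lin by (simp add: linear_map_on_0 lcs_subspace)
    ultimately have "\<forall>\<^sub>F z in F \<times>\<^sub>F F. \<mu> (fst z) - \<mu> (snd z) \<in> V"
      using s(3) topological_tendstoD by fastforce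
    with evT show ?case
      unfolding s(1) case_prod_unfold
      by eventually_elim (simp add: lcs_diff_mem[OF T] linear_map_on_diff[OF lin lcs_subspace[OF T]])
  qed simp
qed

text \<open>
  Testing against functionals avoids the Hahn--Banach theorem, which would be needed to know that
  weak limits are unique.
\<close>

lemma weakly_complete_iff:
  assumes T: "locally_convex_space T" and C: "C \<subseteq> topspace T"
  shows "weakly_complete T C \<longleftrightarrow>
    (\<forall>F. F \<noteq> bot \<and> F \<le> principal C \<and> (\<forall>\<mu>\<in>topological_dual T. \<exists>l. (\<mu> \<longlongrightarrow> l) F) \<longrightarrow>
      (\<exists>c\<in>C. \<forall>\<mu>\<in>topological_dual T. (\<mu> \<longlongrightarrow> \<mu> c) F))"
proof -
  have eq: "(\<forall>U. openin (weak_topology T) U \<and> 0 \<in> U \<longrightarrow>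
        (\<forall>\<^sub>F (x, y) in F \<times>\<^sub>F F. x - y \<in> U)) \<longleftrightarrow>
      (\<forall>\<mu>\<in>topological_dual T. \<exists>l. (\<mu> \<longlongrightarrow> l) F)" (is "?Cauchy F \<longleftrightarrow> ?conv F")
    "(\<exists>c\<in>C. limitin (weak_topology T) (\<lambda>x. x) c F) \<longleftrightarrow>
      (\<exists>c\<in>C. \<forall>\<mu>\<in>topological_dual T. (\<mu> \<longlongrightarrow> \<mu> c) F)"
    if F: "F \<noteq> bot" "F \<le> principal C" for F
  proof -
    have FT: "F \<le> principal (topspace T)"
      using F(2) C by (meson order_trans principal_le_iff)
    then show "?Cauchy F \<longleftrightarrow> ?conv F"
      by (rule weakly_Cauchy_iff[OF T F(1)])
    show "(\<exists>c\<in>C. limitin (weak_topology T) (\<lambda>x. x) c F) \<longleftrightarrow>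
        (\<exists>c\<in>C. \<forall>\<mu>\<in>topological_dual T. (\<mu> \<longlongrightarrow> \<mu> c) F)"
      using FT C limitin_weak_topology_iff[of "\<lambda>x. x" T F] by (auto simp: le_principal)
  qed
  show ?thesis
    unfolding weakly_complete_def complete_subset_def using eq
    by (intro iff_allI imp_cong conj_cong refl) simp_all
qed

lemma fixed_point_property_for_conesD:
  assumes "fixed_point_property_for_cones TYPE('e::real_vector) G TG"
    and "locally_convex_space (T :: 'e topology)" "C \<subseteq> topspace T" "proper_cone C"
      "weakly_complete T C" "cone_representation G T C \<pi>"
      "locally_bounded_right_uniformly_continuous G TG T C \<pi>" "cobounded_type G T C \<pi>"
  obtains x where "x \<in> C" "x \<noteq> 0" "\<forall>g\<in>carrier G. \<pi> g x = x"
  using assms unfolding fixed_point_property_for_cones_def by blast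


section \<open>Images under continuous homomorphisms\<close>

lemma topological_group_continuous_mult:
  assumes G: "topological_group G TG" and f: "continuous_map X TG f" "continuous_map X TG g"
  shows "continuous_map X TG (\<lambda>x. f x \<otimes>\<^bsub>G\<^esub> g x)"
proof -
  have "continuous_map (prod_topology TG TG) TG (\<lambda>(x, y). x \<otimes>\<^bsub>G\<^esub> y)"
    using G by (simp add: topological_group_def)
  from continuous_map_compose[OF _ this, of X "\<lambda>x. (f x, g x)"] show ?thesis
    using f by (simp add: continuous_map_paired o_def)
qed

locale cone_rep =
  fixes G (structure) and T :: "'e::real_vector topology" and C and \<pi>
  assumes lcs: "locally_convex_space T"
    and C_subset: "C \<subseteq> topspace T"
    and rep: "cone_representation G T C \<pi>"
begin

lemma rep_linear: "g \<in> carrier G \<Longrightarrow> linear_map_on (topspace T) (\<pi> g)"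
  and rep_continuous: "g \<in> carrier G \<Longrightarrow> continuous_map T T (\<pi> g)"
  and rep_one: "x \<in> topspace T \<Longrightarrow> \<pi> \<one> x = x"
  and rep_mult: "g \<in> carrier G \<Longrightarrow> h \<in> carrier G \<Longrightarrow> x \<in> topspace T \<Longrightarrow> \<pi> (g \<otimes> h) x = \<pi> g (\<pi> h x)"
  and rep_cone: "g \<in> carrier G \<Longrightarrow> x \<in> C \<Longrightarrow> \<pi> g x \<in> C"
  using rep by (auto simp: cone_representation_def image_subset_iff)

lemma rep_mem: "g \<in> carrier G \<Longrightarrow> x \<in> topspace T \<Longrightarrow> \<pi> g x \<in> topspace T"
  using rep_continuous by (auto simp: continuous_map_def)

end

text \<open>Space and cone stay the same. Surjectivity makes the two orbits of \<open>x\<close>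
  equal as sets, lets the finitely many group elements of the cobounded type be lifted, and turns
  \<open>H\<close>-fixed vectors into \<open>G\<close>-fixed ones; continuity pulls back the
  neighbourhoods of the identity.\<close>

lemma fixed_point_property_for_cones_surjective_image:
  fixes \<phi> :: "'h \<Rightarrow> 'g"
  assumes H: "topological_group H TH" and G: "topological_group G TG"
    and \<phi>: "\<phi> \<in> hom H G" "continuous_map TH TG \<phi>" "\<phi> ` carrier H = carrier G"
    and fpp: "fixed_point_property_for_cones TYPE('e::real_vector) H TH"
  shows "fixed_point_property_for_cones TYPE('e) G TG"
  unfolding fixed_point_property_for_cones_def
proof (intro allI impI, elim conjE)
  fix T :: "'e topology" and C \<pi>
  assume T: "locally_convex_space T" and CT: "C \<subseteq> topspace T" and C: "proper_cone C"
    and wc: "weakly_complete T C" and rep: "cone_representation G T C \<pi>"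
    and uc: "locally_bounded_right_uniformly_continuous G TG T C \<pi>"
    and cb: "cobounded_type G T C \<pi>"
  interpret group_hom H G \<phi>
    using H G \<phi>(1) by (simp add: group_hom_def group_hom_axioms_def topological_group_def)
  define \<rho> where "\<rho> = (\<lambda>h. \<pi> (\<phi> h))"
  have "cone_representation H T C \<rho>"
    using rep unfolding cone_representation_def \<rho>_def by simp
  moreover have "locally_bounded_right_uniformly_continuous H TH T C \<rho>"
  proof -
    obtain x where x: "x \<in> C" "x \<noteq> 0" "bounded_subset T ((\<lambda>g. \<pi> g x) ` carrier G)"
      and unif: "\<And>U. openin T U \<Longrightarrow> 0 \<in> U \<Longrightarrow> \<exists>V. openin TG V \<and> \<one>\<^bsub>G\<^esub> \<in> V \<and>
        (\<forall>a\<in>V. \<forall>g\<in>carrier G. \<pi> (a \<otimes>\<^bsub>G\<^esub> g) x - \<pi> g x \<in> U)"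
      using uc unfolding locally_bounded_right_uniformly_continuous_def by blast
    have "(\<lambda>h. \<rho> h x) ` carrier H = (\<lambda>g. \<pi> g x) ` carrier G"
      unfolding \<phi>(3)[symmetric] \<rho>_def by auto
    moreover have "\<exists>V. openin TH V \<and> \<one>\<^bsub>H\<^esub> \<in> V \<and>
        (\<forall>a\<in>V. \<forall>h\<in>carrier H. \<rho> (a \<otimes>\<^bsub>H\<^esub> h) x - \<rho> h x \<in> U)" if U: "openin T U" "0 \<in> U" for U
    proof -
      obtain V where V: "openin TG V" "\<one>\<^bsub>G\<^esub> \<in> V"
          "\<And>a g. a \<in> V \<Longrightarrow> g \<in> carrier G \<Longrightarrow> \<pi> (a \<otimes>\<^bsub>G\<^esub> g) x - \<pi> g x \<in> U"
        using unif[OF U] by blast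
      show ?thesis
        using V H openin_continuous_map_preimage[OF \<phi>(2) V(1)]
        by (intro exI[of _ "{h \<in> topspace TH. \<phi> h \<in> V}"]) (auto simp: \<rho>_def topological_group_def)
    qed
    ultimately show ?thesis
      using x unfolding locally_bounded_right_uniformly_continuous_def by auto
  qed
  moreover have "cobounded_type H T C \<rho>"
  proof -
    obtain \<mu> where \<mu>: "\<mu> \<in> topological_dual T"
      and dom: "\<And>\<nu>. \<nu> \<in> topological_dual T \<Longrightarrow>
        \<exists>(n::nat) g. (\<forall>j\<in>{1..n}. g j \<in> carrier G) \<and>
          dual_le C \<nu> (\<lambda>x. \<Sum>j=1..n. adjoint_rep G \<pi> (g j) \<mu> x) \<and>
          dual_le C (\<lambda>x. - \<nu> x) (\<lambda>x. \<Sum>j=1..n. adjoint_rep G \<pi> (g j) \<mu> x)"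
      using cb unfolding cobounded_type_def by blast
    have "\<exists>(n::nat) h. (\<forall>j\<in>{1..n}. h j \<in> carrier H) \<and>
        dual_le C \<nu> (\<lambda>x. \<Sum>j=1..n. adjoint_rep H \<rho> (h j) \<mu> x) \<and>
        dual_le C (\<lambda>x. - \<nu> x) (\<lambda>x. \<Sum>j=1..n. adjoint_rep H \<rho> (h j) \<mu> x)"
      if \<nu>: "\<nu> \<in> topological_dual T" for \<nu>
    proof -
      obtain n :: nat and g where g: "\<forall>j\<in>{1..n}. g j \<in> carrier G"
        "dual_le C \<nu> (\<lambda>x. \<Sum>j=1..n. adjoint_rep G \<pi> (g j) \<mu> x)"
        "dual_le C (\<lambda>x. - \<nu> x) (\<lambda>x. \<Sum>j=1..n. adjoint_rep G \<pi> (g j) \<mu> x)"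
        using dom[OF \<nu>] by blast
      have "g j \<in> \<phi> ` carrier H" if "j \<in> {1..n}" for j
        using g(1) that by (simp add: \<phi>(3))
      then obtain h where h: "\<And>j. j \<in> {1..n} \<Longrightarrow> h j \<in> carrier H \<and> \<phi> (h j) = g j"
        unfolding image_iff by metis
      then have "(\<Sum>j=1..n. adjoint_rep H \<rho> (h j) \<mu> x) = (\<Sum>j=1..n. adjoint_rep G \<pi> (g j) \<mu> x)" for x
        by (intro sum.cong refl) (simp add: adjoint_rep_def \<rho>_def)
      then show ?thesis
        using g h by (intro exI[of _ n] exI[of _ h]) simp
    qed
    then show ?thesis
      using \<mu> unfolding cobounded_type_def by blast
  qed
  ultimately obtain x where "x \<in> C" "x \<noteq> 0" "\<forall>h\<in>carrier H. \<rho> h x = x"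
    by (rule fixed_point_property_for_conesD[OF fpp T CT C wc])
  then show "\<exists>x\<in>C. x \<noteq> 0 \<and> (\<forall>g\<in>carrier G. \<pi> g x = x)"
    unfolding \<phi>(3)[symmetric] \<rho>_def by blast
qed


section \<open>Extensions by finite groups\<close>

locale finite_normal_cone_rep = cone_rep G T C \<pi> + normal F G
  for G (structure) and T :: "'e::real_vector topology" and C \<pi> F +
  assumes finite_F: "finite F"
begin

definition average :: "'e \<Rightarrow> 'e" where
  "average x = (1 / card F) *\<^sub>R (\<Sum>f\<in>F. \<pi> f x)"

definition fixed_space :: "'e set" where
  "fixed_space = {x \<in> topspace T. \<forall>f\<in>F. \<pi> f x = x}"

text \<open>A coset acts through an arbitrary representative. This is meaningful on
  \<open>fixed_space\<close> only, where all representatives act alike.\<close>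

definition quotient_rep :: "'a set \<Rightarrow> 'e \<Rightarrow> 'e" where
  "quotient_rep X = \<pi> (SOME g. g \<in> X)"

lemma F_carrier: "f \<in> F \<Longrightarrow> f \<in> carrier G"
  using subset by blast

lemma card_F_pos: "card F > 0"
proof -
  have "F \<noteq> {}"
    using subgroup.one_closed[OF subgroup_axioms] by blast
  then show ?thesis
    using finite_F by (simp add: card_gt_0_iff)
qed

lemma average_mem: "x \<in> topspace T \<Longrightarrow> average x \<in> topspace T"
  unfolding average_def
  by (intro lcs_scaleR_mem[OF lcs] lcs_sum_mem[OF lcs] rep_mem F_carrier)

lemma average_linear: "linear_map_on (topspace T) average"
  unfolding linear_map_on_def average_def
  using rep_linear F_carrier
  by (auto simp: linear_map_on_def sum.distrib scaleR_right_distrib scaleR_sum_right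
      scaleR_left_commute intro!: sum.cong)

lemma average_continuous: "continuous_map T T average"
  unfolding average_def
  by (intro continuous_map_lcs_scaleR_pair[OF lcs] continuous_map_lcs_sum[OF lcs] rep_continuous
      F_carrier) simp_all

text \<open>Reduces both the invariance of averages and their compatibility with \<open>G\<close> to
  reindexing a sum over \<open>F\<close>.\<close>

lemma rep_average_eq_sum:
  assumes "g \<in> carrier G" "x \<in> topspace T"
  shows "\<pi> g (average x) = (1 / card F) *\<^sub>R (\<Sum>f\<in>F. \<pi> (g \<otimes> f) x)"
  using assms
  by (simp add: average_def linear_map_on_scaleR[OF rep_linear] lcs_sum_mem[OF lcs] rep_mem F_carrier
      linear_map_on_sum[OF rep_linear lcs_subspace[OF lcs]] rep_mult)

text \<open>Left multiplication by an element of \<open>F\<close> permutes \<open>F\<close>.\<close>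

lemma average_fixed:
  assumes "x \<in> topspace T"
  shows "average x \<in> fixed_space"
proof -
  have "\<pi> f (average x) = average x" if f: "f \<in> F" for f
  proof -
    have "bij_betw (\<lambda>k. f \<otimes> k) F F"
      using f by (intro bij_betw_byWitness[where f' = "\<lambda>k. inv f \<otimes> k"])
        (auto simp: F_carrier m_assoc[symmetric])
    then have "(\<Sum>k\<in>F. \<pi> (f \<otimes> k) x) = (\<Sum>k\<in>F. \<pi> k x)"
      by (rule sum.reindex_bij_betw)
    then show ?thesis
      by (subst rep_average_eq_sum[OF F_carrier[OF f] assms]) (simp add: average_def)
  qed
  then show ?thesis
    using assms by (simp add: fixed_space_def average_mem)
qed

lemma average_ident: "x \<in> fixed_space \<Longrightarrow> average x = x"
  using card_F_pos by (simp add: average_def fixed_space_def sum_constant_scaleR)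

text \<open>Normality enters here: conjugation by \<open>g\<close> permutes \<open>F\<close>, and
  reindexing by it moves \<open>\<pi> g\<close> past the sum.\<close>

lemma rep_average:
  assumes g: "g \<in> carrier G" and x: "x \<in> topspace T"
  shows "\<pi> g (average x) = average (\<pi> g x)"
proof -
  have "bij_betw (\<lambda>k. g \<otimes> k \<otimes> inv g) F F"
    using g inv_op_closed1 inv_op_closed2
    by (intro bij_betw_byWitness[where f' = "\<lambda>k. inv g \<otimes> k \<otimes> g"])
      (auto simp: F_carrier m_assoc, auto simp: F_carrier m_assoc[symmetric])
  then have "(\<Sum>k\<in>F. \<pi> k (\<pi> g x)) = (\<Sum>k\<in>F. \<pi> (g \<otimes> k \<otimes> inv g) (\<pi> g x))"
    by (rule sum.reindex_bij_betw[symmetric])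
  also have "\<dots> = (\<Sum>k\<in>F. \<pi> (g \<otimes> k) x)"
    using g x by (intro sum.cong refl) (simp add: rep_mult[symmetric] F_carrier m_assoc)
  finally show ?thesis
    by (simp add: rep_average_eq_sum[OF g x] average_def[of "\<pi> g x"])
qed

text \<open>A fixed vector is its own average, so its image under \<open>\<pi> g\<close> is again an
  average.\<close>

lemma rep_fixed_space: "g \<in> carrier G \<Longrightarrow> x \<in> fixed_space \<Longrightarrow> \<pi> g x \<in> fixed_space"
  by (metis (no_types, lifting) average_fixed average_ident rep_average fixed_space_def mem_Collect_eq rep_mem)

text \<open>Stated for subsets of \<open>F\<close> because properness is exploited through the sum
  with the identity term removed.\<close>

lemma sum_rep_cone:
  assumes "proper_cone C" "x \<in> C" "A \<subseteq> F"
  shows "(\<Sum>f\<in>A. \<pi> f x) \<in> C"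
proof -
  have C: "convex_cone C"
    using assms by (simp add: proper_cone_def)
  show ?thesis
    using finite_subset[OF assms(3) finite_F] assms(3)
    by (induction A rule: finite_induct)
      (auto simp: convex_cone_contains_0[OF C] F_carrier assms intro!: convex_cone_add[OF C] rep_cone)
qed

lemma average_cone: "proper_cone C \<Longrightarrow> x \<in> C \<Longrightarrow> average x \<in> C"
  unfolding average_def
  by (intro convex_cone_scaleR sum_rep_cone) (auto simp: proper_cone_def)

text \<open>This is where properness of the cone enters: averaging cannot cancel.\<close>

lemma average_nonzero:
  assumes "proper_cone C" "x \<in> C" "x \<noteq> 0"
  shows "average x \<noteq> 0"
proof
  assume "average x = 0"
  then have "(\<Sum>f\<in>F. \<pi> f x) = 0"
    using card_F_pos by (simp add: average_def)
  \<comment> \<open>Splitting off the identity term exhibits \<open>- x\<close> as a sum of elements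
    of the cone, which contradicts properness.\<close>
  moreover have "(\<Sum>f\<in>F. \<pi> f x) = x + (\<Sum>f\<in>F - {\<one>}. \<pi> f x)"
    using finite_F assms C_subset by (subst sum.remove[of _ \<one>]) (auto simp: rep_one)
  ultimately have eq: "- x = (\<Sum>f\<in>F - {\<one>}. \<pi> f x)"
    by (simp add: eq_neg_iff_add_eq_0 minus_equation_iff neg_eq_iff_add_eq_0)
  have "- x \<in> C"
    unfolding eq using assms by (intro sum_rep_cone) auto
  then have "x \<in> C \<inter> uminus ` C"
    using assms(2) by (auto intro: image_eqI[of _ _ "- x"])
  then show False
    using assms unfolding proper_cone_def by blast
qed

text \<open>The chosen representative is \<open>f \<otimes> g\<close> with \<open>f \<in> F\<close>,
  and \<open>f\<close> acts trivially on \<open>\<pi> g x\<close>, which is again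
  \<open>F\<close>-fixed.\<close>

lemma quotient_rep_coset:
  assumes g: "g \<in> carrier G" and x: "x \<in> fixed_space"
  shows "quotient_rep (F #> g) x = \<pi> g x"
proof -
  have "g \<in> F #> g"
    using g by (rule rcos_self[OF _ subgroup_axioms])
  then have "(SOME k. k \<in> F #> g) \<in> F #> g"
    by (rule someI)
  then obtain f where f: "f \<in> F" "(SOME k. k \<in> F #> g) = f \<otimes> g"
    by (auto simp: r_coset_def)
  then show ?thesis
    using rep_fixed_space[OF g x] x g
    by (simp add: quotient_rep_def rep_mult F_carrier fixed_space_def)
qed

section \<open>The \<open>F\<close>-fixed vectors as a locally convex space with a weakly complete
  proper cone\<close>

abbreviation fixed_topology :: "'e topology" where
  "fixed_topology \<equiv> subtopology T fixed_space"

lemma fixed_space_subset: "fixed_space \<subseteq> topspace T"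
  by (auto simp: fixed_space_def)

lemma topspace_fixed_topology: "topspace fixed_topology = fixed_space"
  using fixed_space_subset by auto

lemma subspace_fixed_space: "subspace fixed_space"
  unfolding subspace_def fixed_space_def
  using rep_linear F_carrier lcs_zero_mem[OF lcs] lcs_add_mem[OF lcs] lcs_scaleR_mem[OF lcs]
  by (auto simp: linear_map_on_def linear_map_on_0[OF rep_linear lcs_subspace[OF lcs]])

lemma lcs_fixed_topology: "locally_convex_space fixed_topology"
  by (rule locally_convex_space_subtopology[OF lcs subspace_fixed_space fixed_space_subset])

lemma average_continuous_fixed: "continuous_map T fixed_topology average"
  using average_continuous average_fixed by (auto simp: continuous_map_in_subtopology)

lemma topological_dual_average:
  "\<mu> \<in> topological_dual fixed_topology \<Longrightarrow> (\<lambda>x. \<mu> (average x)) \<in> topological_dual T"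
  by (rule topological_dual_compose[OF _ average_linear average_continuous_fixed])

lemma topological_dual_restrict:
  "\<mu> \<in> topological_dual T \<Longrightarrow> \<mu> \<in> topological_dual fixed_topology"
  using fixed_space_subset
  by (auto simp: topological_dual_def linear_map_on_def topspace_fixed_topology subset_iff
      simp del: topspace_subtopology intro: continuous_map_from_subtopology)

lemma proper_cone_fixed:
  assumes "proper_cone C"
  shows "proper_cone (C \<inter> fixed_space)"
proof -
  have C: "convex_cone C" "C \<inter> uminus ` C = {0}"
    using assms by (auto simp: proper_cone_def)
  then have "convex_cone (C \<inter> fixed_space)"
    using subspace_fixed_space unfolding convex_cone_iff subspace_def by auto
  moreover have "0 \<in> C \<inter> fixed_space"
    using calculation by (rule convex_cone_contains_0)
  ultimately show ?thesis
    using C by (auto simp: proper_cone_def intro: image_eqI[of _ _ 0])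
qed

text \<open>The limit \<open>c\<close> found in \<open>C\<close> is not known to be
  \<open>F\<close>-fixed, so \<open>average c\<close> takes its place. For a functional
  \<open>\<mu>\<close> on the fixed vectors, \<open>\<mu>\<close> composed with
  \<open>average\<close> lives on all of \<open>T\<close> and agrees with \<open>\<mu>\<close> along
  the filter, hence has the required limit.\<close>

lemma weakly_complete_fixed:
  assumes C: "proper_cone C" and wc: "weakly_complete T C"
  shows "weakly_complete fixed_topology (C \<inter> fixed_space)"
proof (subst weakly_complete_iff[OF lcs_fixed_topology], use topspace_fixed_topology in blast,
    intro allI impI, elim conjE)
  fix \<F> assume \<F>: "\<F> \<noteq> bot" "\<F> \<le> principal (C \<inter> fixed_space)"
    and conv: "\<forall>\<mu>\<in>topological_dual fixed_topology. \<exists>l. (\<mu> \<longlongrightarrow> l) \<F>"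
  have "\<F> \<le> principal C"
    using \<F>(2) by (meson Int_lower1 order_trans principal_le_iff)
  moreover have "\<forall>\<mu>\<in>topological_dual T. \<exists>l. (\<mu> \<longlongrightarrow> l) \<F>"
    using conv topological_dual_restrict by blast
  ultimately obtain c where c: "c \<in> C" "\<And>\<mu>. \<mu> \<in> topological_dual T \<Longrightarrow> (\<mu> \<longlongrightarrow> \<mu> c) \<F>"
    using wc \<F>(1) unfolding weakly_complete_iff[OF lcs C_subset] by blast
  have "(\<mu> \<longlongrightarrow> \<mu> (average c)) \<F>" if "\<mu> \<in> topological_dual fixed_topology" for \<mu>
  proof (rule Lim_transform_eventually)
    show "((\<lambda>x. \<mu> (average x)) \<longlongrightarrow> \<mu> (average c)) \<F>"
      using c(2)[OF topological_dual_average[OF that]] .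
    have "\<forall>\<^sub>F x in \<F>. x \<in> C \<inter> fixed_space"
      using \<F>(2) by (simp add: le_principal)
    then show "\<forall>\<^sub>F x in \<F>. \<mu> (average x) = \<mu> x"
      by eventually_elim (simp add: average_ident)
  qed
  moreover have "average c \<in> C \<inter> fixed_space"
    using c(1) C C_subset by (auto simp: average_cone average_fixed)
  ultimately show "\<exists>c\<in>C \<inter> fixed_space. \<forall>\<mu>\<in>topological_dual fixed_topology. (\<mu> \<longlongrightarrow> \<mu> c) \<F>"
    by blast
qed

section \<open>The quotient group acting on the fixed vectors\<close>

lemma carrier_quotient: "X \<in> carrier (G Mod F) \<Longrightarrow> \<exists>g\<in>carrier G. X = F #> g"
  by (auto simp: FactGroup_def RCOSETS_def)

lemma coset_carrier: "g \<in> carrier G \<Longrightarrow> F #> g \<in> carrier (G Mod F)"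
  by (auto simp: FactGroup_def RCOSETS_def)

lemma coset_inv: "g \<in> carrier G \<Longrightarrow> inv\<^bsub>G Mod F\<^esub> (F #> g) = F #> inv g"
  by (simp add: inv_FactGroup coset_carrier rcos_inv)

lemma coset_one: "\<one>\<^bsub>G Mod F\<^esub> = F #> \<one>"
  by (simp add: FactGroup_def coset_mult_one[OF subset])

lemma cone_representation_quotient:
  "cone_representation (G Mod F) fixed_topology (C \<inter> fixed_space) quotient_rep"
  unfolding cone_representation_def topspace_fixed_topology
proof (intro conjI ballI)
  fix X assume "X \<in> carrier (G Mod F)"
  then obtain g where g: "g \<in> carrier G" "X = F #> g"
    using carrier_quotient by blast
  show "linear_map_on fixed_space (quotient_rep X)"
    using rep_linear[OF g(1)] subspace_fixed_space fixed_space_subset g quotient_rep_coset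
    unfolding linear_map_on_def g(2) by (auto simp: subspace_def subset_iff)
  have "continuous_map fixed_topology fixed_topology (\<pi> g)"
    using rep_fixed_space[OF g(1)] rep_continuous[OF g(1)]
    by (auto simp: continuous_map_in_subtopology continuous_map_from_subtopology)
  then show "continuous_map fixed_topology fixed_topology (quotient_rep X)"
    by (rule continuous_map_eq) (use g quotient_rep_coset in auto)
  show "quotient_rep X ` (C \<inter> fixed_space) \<subseteq> C \<inter> fixed_space"
    using g rep_cone rep_fixed_space by (auto simp: quotient_rep_coset)
next
  fix x assume x: "x \<in> fixed_space"
  then have "quotient_rep \<one>\<^bsub>G Mod F\<^esub> x = \<pi> \<one> x"
    unfolding coset_one by (rule quotient_rep_coset[OF monoid.one_closed[OF monoid_axioms]])
  then show "quotient_rep \<one>\<^bsub>G Mod F\<^esub> x = x"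
    using x fixed_space_subset by (auto simp: rep_one)
next
  fix X Y x assume "X \<in> carrier (G Mod F)" "Y \<in> carrier (G Mod F)" and x: "x \<in> fixed_space"
  then obtain g h where g: "g \<in> carrier G" "X = F #> g" "h \<in> carrier G" "Y = F #> h"
    using carrier_quotient by blast
  then show "quotient_rep (X \<otimes>\<^bsub>G Mod F\<^esub> Y) x = quotient_rep X (quotient_rep Y x)"
    using x fixed_space_subset
    by (auto simp: rcos_sum quotient_rep_coset rep_fixed_space rep_mult)
qed

text \<open>The quotient map is open: the saturation of \<open>V\<close> is the union of its
  translates by elements of \<open>F\<close>, and each translate is open.\<close>

lemma openin_quotient_image:
  assumes G: "topological_group G TG" and V: "openin TG V"
  shows "openin (quotient_group_topology G TG F) ((\<lambda>x. F #> x) ` V)"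
  unfolding openin_quotient_group_topology
proof
  have tG: "topspace TG = carrier G"
    using G by (simp add: topological_group_def)
  then have VG: "V \<subseteq> carrier G"
    using openin_subset[OF V] by simp
  then show "(\<lambda>x. F #> x) ` V \<subseteq> carrier (G Mod F)"
    using coset_carrier by blast
  have "{x \<in> topspace TG. F #> x \<in> (\<lambda>x. F #> x) ` V} =
      (\<Union>f\<in>F. {x \<in> topspace TG. inv f \<otimes> x \<in> V})" (is "?L = ?R")
  proof
    show "?L \<subseteq> ?R"
    proof
      fix x assume "x \<in> ?L"
      then obtain v where v: "x \<in> carrier G" "v \<in> V" "F #> x = F #> v"
        using tG by auto
      then have "x \<in> F #> v"
        using rcos_self[OF _ subgroup_axioms] by blast
      then obtain f where "f \<in> F" "x = f \<otimes> v"
        by (auto simp: r_coset_def)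
      then show "x \<in> ?R"
        using v VG tG by (intro UN_I[of f]) (auto simp: F_carrier m_assoc[symmetric])
    qed
    show "?R \<subseteq> ?L"
    proof
      fix x assume "x \<in> ?R"
      then obtain f where f: "f \<in> F" "x \<in> carrier G" "inv f \<otimes> x \<in> V"
        using tG by auto
      then have "F #> x = F #> (inv f \<otimes> x)"
        by (intro repr_independence[OF _ _ subgroup_axioms]) (auto simp: r_coset_def)
      then show "x \<in> ?L"
        using f tG by auto
    qed
  qed
  moreover have "openin TG {x \<in> topspace TG. inv f \<otimes> x \<in> V}" if "f \<in> F" for f
    using that tG
    by (intro openin_continuous_map_preimage[OF _ V] topological_group_continuous_mult[OF G])
      (auto simp: F_carrier)
  ultimately show "openin TG {x \<in> topspace TG. F #> x \<in> (\<lambda>x. F #> x) ` V}"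
    by (auto intro: openin_Union)
qed

text \<open>The new base vector is \<open>average x\<close>. Averaging commutes with the action, so
  its orbit is the image of the old orbit under a continuous linear map; properness of
  \<open>C\<close> keeps it non-zero.\<close>

lemma uniformly_continuous_quotient:
  assumes G: "topological_group G TG" and C: "proper_cone C"
    and uc: "locally_bounded_right_uniformly_continuous G TG T C \<pi>"
  shows "locally_bounded_right_uniformly_continuous (G Mod F) (quotient_group_topology G TG F)
    fixed_topology (C \<inter> fixed_space) quotient_rep"
proof -
  obtain x where x: "x \<in> C" "x \<noteq> 0" "bounded_subset T ((\<lambda>g. \<pi> g x) ` carrier G)"
    and unif: "\<And>U. openin T U \<Longrightarrow> 0 \<in> U \<Longrightarrow> \<exists>V. openin TG V \<and> \<one> \<in> V \<and>
        (\<forall>a\<in>V. \<forall>g\<in>carrier G. \<pi> (a \<otimes> g) x - \<pi> g x \<in> U)"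
    using uc unfolding locally_bounded_right_uniformly_continuous_def by blast
  have xT: "x \<in> topspace T"
    using x(1) C_subset by blast
  have rep_eq: "quotient_rep (F #> g) (average x) = average (\<pi> g x)" if "g \<in> carrier G" for g
    using that xT by (simp add: quotient_rep_coset average_fixed rep_average)
  have "(\<lambda>X. quotient_rep X (average x)) ` carrier (G Mod F) = average ` (\<lambda>g. \<pi> g x) ` carrier G"
  proof -
    have "carrier (G Mod F) = (\<lambda>g. F #> g) ` carrier G"
      using carrier_quotient coset_carrier by blast
    then show ?thesis
      using rep_eq by (simp add: image_image)
  qed
  then have "bounded_subset fixed_topology ((\<lambda>X. quotient_rep X (average x)) ` carrier (G Mod F))"
    using bounded_subset_linear_image[OF x(3) lcs lcs_fixed_topology average_linear
        average_continuous_fixed] by simp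
  moreover have "\<exists>V. openin (quotient_group_topology G TG F) V \<and> \<one>\<^bsub>G Mod F\<^esub> \<in> V \<and>
      (\<forall>A\<in>V. \<forall>X\<in>carrier (G Mod F).
        quotient_rep (A \<otimes>\<^bsub>G Mod F\<^esub> X) (average x) - quotient_rep X (average x) \<in> U)"
    if U: "openin fixed_topology U" "0 \<in> U" for U
  proof -
    \<comment> \<open>Pulling \<open>U\<close> back along \<open>average\<close> reduces the
      estimate to the one known for \<open>x\<close>.\<close>
    have "openin T {y \<in> topspace T. average y \<in> U}" "0 \<in> {y \<in> topspace T. average y \<in> U}"
      using U(2) openin_continuous_map_preimage[OF average_continuous_fixed U(1)]
        lcs_zero_mem[OF lcs] linear_map_on_0[OF average_linear lcs_subspace[OF lcs]] by simp_all
    then obtain V where V: "openin TG V" "\<one> \<in> V"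
        "\<And>a g. a \<in> V \<Longrightarrow> g \<in> carrier G \<Longrightarrow> average (\<pi> (a \<otimes> g) x - \<pi> g x) \<in> U"
      using unif[of "{y \<in> topspace T. average y \<in> U}"] by blast
    have VG: "V \<subseteq> carrier G"
      using G openin_subset[OF V(1)] by (simp add: topological_group_def)
    have "quotient_rep (A \<otimes>\<^bsub>G Mod F\<^esub> X) (average x) - quotient_rep X (average x) \<in> U"
      if A: "A \<in> (\<lambda>x. F #> x) ` V" and X: "X \<in> carrier (G Mod F)" for A X
    proof -
      obtain a g where a: "a \<in> V" "A = F #> a" and g: "g \<in> carrier G" "X = F #> g"
        using A carrier_quotient[OF X] by blast
      then have "a \<in> carrier G"
        using VG by blast
      then show ?thesis
        using V(3)[OF a(1) g(1)] a g xT
        by (simp add: rcos_sum rep_eq rep_mem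
            linear_map_on_diff[OF average_linear lcs_subspace[OF lcs]])
    qed
    then show ?thesis
      using openin_quotient_image[OF G V(1)] V(2) coset_one
      by (intro exI[of _ "(\<lambda>x. F #> x) ` V"]) auto
  qed
  ultimately show ?thesis
    unfolding locally_bounded_right_uniformly_continuous_def
    using average_cone[OF C x(1)] average_nonzero[OF C x(1,2)] average_fixed[OF xT]
    by (intro bexI[of _ "average x"]) auto
qed

text \<open>The restriction of \<open>\<mu>\<close> dominates: extend \<open>\<nu>\<close> by
  averaging, dominate the extension on all of \<open>C\<close>, and read the inequalities on fixed
  vectors, where \<open>average\<close> is the identity.\<close>

lemma cobounded_type_quotient:
  assumes C: "proper_cone C" and cb: "cobounded_type G T C \<pi>"
  shows "cobounded_type (G Mod F) fixed_topology (C \<inter> fixed_space) quotient_rep"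
proof -
  obtain \<mu> where \<mu>: "\<mu> \<in> topological_dual T"
    and dom: "\<And>\<nu>. \<nu> \<in> topological_dual T \<Longrightarrow>
      \<exists>(n::nat) g. (\<forall>j\<in>{1..n}. g j \<in> carrier G) \<and>
        dual_le C \<nu> (\<lambda>x. \<Sum>j=1..n. adjoint_rep G \<pi> (g j) \<mu> x) \<and>
        dual_le C (\<lambda>x. - \<nu> x) (\<lambda>x. \<Sum>j=1..n. adjoint_rep G \<pi> (g j) \<mu> x)"
    using cb unfolding cobounded_type_def by blast
  have "\<exists>(n::nat) g. (\<forall>j\<in>{1..n}. g j \<in> carrier (G Mod F)) \<and>
      dual_le (C \<inter> fixed_space) \<nu> (\<lambda>x. \<Sum>j=1..n. adjoint_rep (G Mod F) quotient_rep (g j) \<mu> x) \<and>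
      dual_le (C \<inter> fixed_space) (\<lambda>x. - \<nu> x) (\<lambda>x. \<Sum>j=1..n. adjoint_rep (G Mod F) quotient_rep (g j) \<mu> x)"
    if \<nu>: "\<nu> \<in> topological_dual fixed_topology" for \<nu>
  proof -
    obtain n :: nat and g where g: "\<forall>j\<in>{1..n}. g j \<in> carrier G"
      "dual_le C (\<lambda>x. \<nu> (average x)) (\<lambda>x. \<Sum>j=1..n. adjoint_rep G \<pi> (g j) \<mu> x)"
      "dual_le C (\<lambda>x. - \<nu> (average x)) (\<lambda>x. \<Sum>j=1..n. adjoint_rep G \<pi> (g j) \<mu> x)"
      using dom[OF topological_dual_average[OF \<nu>]] by blast
    have "(\<Sum>j=1..n. adjoint_rep (G Mod F) quotient_rep (F #> g j) \<mu> x) =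
        (\<Sum>j=1..n. adjoint_rep G \<pi> (g j) \<mu> x)" if "x \<in> fixed_space" for x
      using g(1) that by (intro sum.cong refl) (simp add: adjoint_rep_def coset_inv quotient_rep_coset)
    then show ?thesis
      using g by (intro exI[of _ n] exI[of _ "\<lambda>j. F #> g j"])
        (auto simp: dual_le_def average_ident coset_carrier)
  qed
  then show ?thesis
    using topological_dual_restrict[OF \<mu>] unfolding cobounded_type_def by blast
qed

end

lemma fixed_point_property_for_cones_finite_extension:
  assumes G: "topological_group G TG" and F: "F \<lhd> G" "finite F"
    and fpp: "fixed_point_property_for_cones TYPE('e::real_vector) (G Mod F)
      (quotient_group_topology G TG F)"
  shows "fixed_point_property_for_cones TYPE('e) G TG"
  unfolding fixed_point_property_for_cones_def
proof (intro allI impI, elim conjE)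
  fix T :: "'e topology" and C \<pi>
  assume T: "locally_convex_space T" and CT: "C \<subseteq> topspace T" and C: "proper_cone C"
    and wc: "weakly_complete T C" and rep: "cone_representation G T C \<pi>"
    and uc: "locally_bounded_right_uniformly_continuous G TG T C \<pi>"
    and cb: "cobounded_type G T C \<pi>"
  interpret finite_normal_cone_rep G T C \<pi> F
    using G F T CT rep
    by (intro finite_normal_cone_rep.intro cone_rep.intro finite_normal_cone_rep_axioms.intro) auto
  have "C \<inter> fixed_space \<subseteq> topspace fixed_topology"
    using topspace_fixed_topology by blast
  then obtain x where x: "x \<in> C \<inter> fixed_space" "x \<noteq> 0"
      "\<forall>X\<in>carrier (G Mod F). quotient_rep X x = x"
    by (rule fixed_point_property_for_conesD[OF fpp lcs_fixed_topology _ proper_cone_fixed[OF C]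
          weakly_complete_fixed[OF C wc] cone_representation_quotient
          uniformly_continuous_quotient[OF G C uc] cobounded_type_quotient[OF C cb]])
  \<comment> \<open>On \<open>F\<close>-fixed vectors \<open>g\<close> acts as its coset
    does.\<close>
  have "\<pi> g x = x" if "g \<in> carrier G" for g
    using that x coset_carrier[OF that] by (metis IntD2 quotient_rep_coset)
  then show "\<exists>x\<in>C. x \<noteq> 0 \<and> (\<forall>g\<in>carrier G. \<pi> g x = x)"
    using x by blast
qed

section \<open>Open subgroups: induced representations\<close>

locale induced_rep = group G + subgroup H G + sub: cone_rep "G\<lparr>carrier := H\<rparr>" T C \<pi>
  for G :: "'a monoid" (structure) and H and T :: "'e::real_vector topology" and C \<pi> +
  assumes C: "proper_cone C"
begin

lemmas lcs = sub.lcs and C_subset = sub.C_subset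
lemmas rep_linear = sub.rep_linear[simplified] and rep_continuous = sub.rep_continuous[simplified]
  and rep_one = sub.rep_one[simplified] and rep_mult = sub.rep_mult[simplified]
  and rep_cone = sub.rep_cone[simplified] and rep_mem = sub.rep_mem[simplified]

lemma rep_zero: "h \<in> H \<Longrightarrow> \<pi> h 0 = 0"
  using linear_map_on_0[OF rep_linear lcs_subspace[OF lcs]] .

lemma zero_C: "0 \<in> C"
  using C convex_cone_contains_0 by (auto simp: proper_cone_def)

section \<open>Left cosets of \<open>H\<close> and their representatives\<close>

lemma mult_inv_cancel:
  assumes "x \<in> carrier G" "y \<in> carrier G"
  shows "x \<otimes> (inv x \<otimes> y) = y" "inv x \<otimes> (x \<otimes> y) = y"
  using assms by (simp_all add: m_assoc[symmetric])

text \<open>Equality of the left cosets \<open>xH\<close> and \<open>yH\<close>, the cosets that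
  left translation by \<open>G\<close> permutes.\<close>

definition same_coset :: "'a \<Rightarrow> 'a \<Rightarrow> bool" where
  "same_coset x y \<longleftrightarrow> inv x \<otimes> y \<in> H"

lemma same_coset_refl: "x \<in> carrier G \<Longrightarrow> same_coset x x"
  by (simp add: same_coset_def)

lemma same_coset_sym:
  assumes "x \<in> carrier G" "y \<in> carrier G" "same_coset x y"
  shows "same_coset y x"
proof -
  have "inv (inv x \<otimes> y) \<in> H"
    using assms by (simp add: same_coset_def)
  then show ?thesis
    using assms by (simp add: same_coset_def inv_mult_group)
qed

lemma same_coset_trans:
  assumes "x \<in> carrier G" "y \<in> carrier G" "z \<in> carrier G" "same_coset x y" "same_coset y z"
  shows "same_coset x z"
proof -
  have "(inv x \<otimes> y) \<otimes> (inv y \<otimes> z) \<in> H"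
    using assms by (simp add: same_coset_def)
  moreover have "(inv x \<otimes> y) \<otimes> (inv y \<otimes> z) = inv x \<otimes> z"
    using assms by (simp add: m_assoc mult_inv_cancel)
  ultimately show ?thesis
    by (simp add: same_coset_def)
qed

lemma same_coset_translate:
  assumes "g \<in> carrier G" "x \<in> carrier G" "y \<in> carrier G"
  shows "inv (g \<otimes> x) \<otimes> (g \<otimes> y) = inv x \<otimes> y"
  using assms by (simp add: inv_mult_group m_assoc mult_inv_cancel)

definition coset_rep :: "'a \<Rightarrow> 'a" where
  "coset_rep x = (SOME y. y \<in> carrier G \<and> same_coset x y)"

lemma coset_rep:
  assumes "x \<in> carrier G"
  shows "coset_rep x \<in> carrier G" "same_coset x (coset_rep x)"
  using someI[of "\<lambda>y. y \<in> carrier G \<and> same_coset x y" x] assms same_coset_refl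
  by (auto simp: coset_rep_def)

text \<open>The predicates under \<open>SOME\<close> are equivalent for two points of one coset, so
  the same element is chosen.\<close>

lemma coset_rep_cong:
  assumes "x \<in> carrier G" "y \<in> carrier G" "same_coset x y"
  shows "coset_rep x = coset_rep y"
proof -
  have "(z \<in> carrier G \<and> same_coset x z) = (z \<in> carrier G \<and> same_coset y z)" for z
    using assms same_coset_trans same_coset_sym by blast
  then show ?thesis
    by (simp add: coset_rep_def)
qed

text \<open>
  The space induced from \<open>H\<close> to \<open>G\<close>: functions \<open>f\<close> on \<open>G\<close> with \<open>f (y h) = \<pi> (h\<^sup>-\<^sup>1) (f y)\<close> for
  \<open>h \<in> H\<close>, extended by \<open>0\<close> outside the carrier so that they form a linear subspace.
\<close>

definition induced_space :: "('a \<Rightarrow> 'e) set" where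
  "induced_space = {f. (\<forall>x. f x \<in> topspace T) \<and> (\<forall>x. x \<notin> carrier G \<longrightarrow> f x = 0) \<and>
     (\<forall>x\<in>carrier G. \<forall>y\<in>carrier G. same_coset y x \<longrightarrow> f x = \<pi> (inv x \<otimes> y) (f y))}"

definition induced_topology :: "('a \<Rightarrow> 'e) topology" where
  "induced_topology = subtopology (product_topology (\<lambda>_. T) UNIV) induced_space"

definition induced_cone :: "('a \<Rightarrow> 'e) set" where
  "induced_cone = {f \<in> induced_space. \<forall>x. f x \<in> C}"

definition translate :: "'a \<Rightarrow> ('a \<Rightarrow> 'e) \<Rightarrow> 'a \<Rightarrow> 'e" where
  "translate g f = (\<lambda>x. if x \<in> carrier G then f (inv g \<otimes> x) else 0)"

text \<open>For \<open>r\<close> in the carrier, the equivariant function supported on the coset of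
  \<open>r\<close> with value \<open>e\<close> at \<open>r\<close>: the embedding of one factor of
  the product.\<close>

definition inject :: "'a \<Rightarrow> 'e \<Rightarrow> 'a \<Rightarrow> 'e" where
  "inject r e = (\<lambda>x. if x \<in> carrier G \<and> same_coset r x then \<pi> (inv x \<otimes> r) e else 0)"

section \<open>Equivariant functions as a locally convex space\<close>

lemma induced_space_mem: "f \<in> induced_space \<Longrightarrow> f x \<in> topspace T"
  by (simp add: induced_space_def)

lemma induced_space_outside: "f \<in> induced_space \<Longrightarrow> x \<notin> carrier G \<Longrightarrow> f x = 0"
  by (simp add: induced_space_def)

lemma induced_space_equivariant:
  "f \<in> induced_space \<Longrightarrow> x \<in> carrier G \<Longrightarrow> y \<in> carrier G \<Longrightarrow> same_coset y x \<Longrightarrow>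
    f x = \<pi> (inv x \<otimes> y) (f y)"
  by (simp add: induced_space_def)

lemma same_coset_mem: "x \<in> carrier G \<Longrightarrow> y \<in> carrier G \<Longrightarrow> same_coset y x \<Longrightarrow> inv x \<otimes> y \<in> H"
  using same_coset_sym same_coset_def by blast

lemma topspace_induced_topology: "topspace induced_topology = induced_space"
  by (auto simp: induced_topology_def induced_space_def PiE_iff)

lemma subspace_induced_space: "subspace induced_space"
  unfolding subspace_def
proof (intro conjI ballI allI)
  show "0 \<in> induced_space"
    by (auto simp: induced_space_def rep_zero same_coset_mem lcs_zero_mem[OF lcs])
next
  fix f f' assume f: "f \<in> induced_space" "f' \<in> induced_space"
  show "f + f' \<in> induced_space"
    unfolding induced_space_def
    using induced_space_mem[OF f(1)] induced_space_mem[OF f(2)] induced_space_outside[OF f(1)]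
      induced_space_outside[OF f(2)] induced_space_equivariant[OF f(1)] induced_space_equivariant[OF f(2)]
    by (auto simp: lcs_add_mem[OF lcs] linear_map_on_add[OF rep_linear] same_coset_mem)
next
  fix r f assume f: "f \<in> induced_space"
  show "r *\<^sub>R f \<in> induced_space"
    unfolding induced_space_def
    using induced_space_mem[OF f] induced_space_outside[OF f] induced_space_equivariant[OF f]
    by (auto simp: lcs_scaleR_mem[OF lcs] linear_map_on_scaleR[OF rep_linear] same_coset_mem
        scaleR_fun_def)
qed

lemma lcs_induced_topology: "locally_convex_space induced_topology"
  unfolding induced_topology_def
  by (intro locally_convex_space_subtopology locally_convex_space_product lcs subspace_induced_space)
    (auto simp: induced_space_mem PiE_iff)

lemma eval_continuous: "continuous_map induced_topology T (\<lambda>f. f x)"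
  unfolding induced_topology_def
  by (intro continuous_map_from_subtopology continuous_map_product_projection) simp

lemma eval_linear: "linear_map_on (topspace induced_topology) (\<lambda>f. f x)"
  by (simp add: linear_map_on_def scaleR_fun_def)

lemma continuous_map_induced_topology:
  assumes "\<And>x. continuous_map X T (\<lambda>z. F z x)" "\<And>z. z \<in> topspace X \<Longrightarrow> F z \<in> induced_space"
  shows "continuous_map X induced_topology F"
  using assms by (auto simp: induced_topology_def continuous_map_in_subtopology
      continuous_map_componentwise_UNIV)

section \<open>Embedding a single coordinate\<close>

lemma inject_mem:
  assumes r: "r \<in> carrier G" and e: "e \<in> topspace T"
  shows "inject r e \<in> induced_space"
  unfolding induced_space_def
proof (intro CollectI conjI allI ballI impI)
  show "inject r e x \<in> topspace T" for x
    using r e by (auto simp: inject_def rep_mem same_coset_mem lcs_zero_mem[OF lcs])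
  show "inject r e x = 0" if "x \<notin> carrier G" for x
    using that by (simp add: inject_def)
  fix x y assume xy: "x \<in> carrier G" "y \<in> carrier G" "same_coset y x"
  show "inject r e x = \<pi> (inv x \<otimes> y) (inject r e y)"
  proof (cases "same_coset r x")
    case True
    then have ry: "same_coset r y"
      using xy r same_coset_sym same_coset_trans by blast
    have "\<pi> ((inv x \<otimes> y) \<otimes> (inv y \<otimes> r)) e = \<pi> (inv x \<otimes> y) (\<pi> (inv y \<otimes> r) e)"
      using xy r ry e by (intro rep_mult same_coset_mem)
    moreover have "(inv x \<otimes> y) \<otimes> (inv y \<otimes> r) = inv x \<otimes> r"
      using xy r by (simp add: m_assoc mult_inv_cancel)
    ultimately show ?thesis
      using True ry xy by (simp add: inject_def)
  next
    case False
    then have "\<not> same_coset r y"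
      using xy r same_coset_trans by blast
    then show ?thesis
      using False xy by (simp add: inject_def rep_zero same_coset_mem)
  qed
qed

text \<open>Equivariance determines a function on a whole coset by one value, so injecting that
  value recovers the function there.\<close>

lemma inject_eval:
  assumes "f \<in> induced_space" "r \<in> carrier G" "x \<in> carrier G" "same_coset r x"
  shows "inject r (f r) x = f x"
  using assms induced_space_equivariant[OF assms(1,3,2,4)] by (simp add: inject_def)

lemma inject_linear:
  assumes "r \<in> carrier G"
  shows "linear_map_on (topspace T) (inject r)"
  using assms
  by (auto simp: linear_map_on_def inject_def fun_eq_iff scaleR_fun_def same_coset_mem
      linear_map_on_add[OF rep_linear] linear_map_on_scaleR[OF rep_linear])

lemma inject_continuous:
  assumes r: "r \<in> carrier G"
  shows "continuous_map T induced_topology (inject r)"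
proof (rule continuous_map_induced_topology)
  show "continuous_map T T (\<lambda>e. inject r e x)" for x
  proof (cases "x \<in> carrier G \<and> same_coset r x")
    case True
    then show ?thesis
      using r rep_continuous[OF same_coset_mem[of x r]] by (simp add: inject_def)
  next
    case False
    then have "(\<lambda>e. inject r e x) = (\<lambda>_. 0)"
      by (auto simp: inject_def)
    then show ?thesis
      using lcs_zero_mem[OF lcs] by simp
  qed
qed (rule inject_mem[OF r])

lemma inject_cone:
  assumes "r \<in> carrier G" "e \<in> C"
  shows "inject r e \<in> induced_cone"
  using assms inject_mem C_subset
  by (auto simp: induced_cone_def inject_def rep_cone same_coset_mem zero_C)

text \<open>Translation moves the supporting coset and keeps the vector, so the orbit of
  \<open>inject \<one> x\<close> consists of the functions \<open>inject g x\<close>.\<close>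

lemma translate_inject:
  assumes "g \<in> carrier G" "r \<in> carrier G"
  shows "translate g (inject r e) = inject (g \<otimes> r) e"
proof
  fix x
  show "translate g (inject r e) x = inject (g \<otimes> r) e x"
  proof (cases "x \<in> carrier G")
    case True
    then have "inv r \<otimes> (inv g \<otimes> x) = inv (g \<otimes> r) \<otimes> x" "inv (inv g \<otimes> x) \<otimes> r = inv x \<otimes> (g \<otimes> r)"
      using assms by (simp_all add: inv_mult_group m_assoc)
    then show ?thesis
      using True assms by (simp add: translate_def inject_def same_coset_def)
  qed (simp add: translate_def inject_def)
qed

section \<open>Translation as a cone representation of \<open>G\<close>\<close>

lemma translate_mem:
  assumes g: "g \<in> carrier G" and f: "f \<in> induced_space"
  shows "translate g f \<in> induced_space"
  unfolding induced_space_def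
proof (intro CollectI conjI allI ballI impI)
  fix x y assume xy: "x \<in> carrier G" "y \<in> carrier G" "same_coset y x"
  have eq: "inv (inv g \<otimes> x) \<otimes> (inv g \<otimes> y) = inv x \<otimes> y"
    "inv (inv g \<otimes> y) \<otimes> (inv g \<otimes> x) = inv y \<otimes> x"
    using xy g by (simp_all add: same_coset_translate)
  have "f (inv g \<otimes> x) = \<pi> (inv (inv g \<otimes> x) \<otimes> (inv g \<otimes> y)) (f (inv g \<otimes> y))"
    using xy g eq by (intro induced_space_equivariant[OF f]) (simp_all add: same_coset_def)
  then show "translate g f x = \<pi> (inv x \<otimes> y) (translate g f y)"
    using xy by (simp add: translate_def eq)
qed (use f lcs_zero_mem[OF lcs] induced_space_mem in \<open>auto simp: translate_def\<close>)

lemma translate_continuous: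
  assumes g: "g \<in> carrier G"
  shows "continuous_map induced_topology induced_topology (translate g)"
proof (rule continuous_map_induced_topology)
  show "continuous_map induced_topology T (\<lambda>f. translate g f x)" for x
    using eval_continuous lcs_zero_mem[OF lcs] by (cases "x \<in> carrier G") (simp_all add: translate_def)
qed (simp add: topspace_induced_topology translate_mem[OF g])

lemma induced_cone_subset: "induced_cone \<subseteq> topspace induced_topology"
  by (auto simp: topspace_induced_topology induced_cone_def)

lemma cone_representation_induced: "cone_representation G induced_topology induced_cone translate"
  unfolding cone_representation_def
proof (intro conjI ballI)
  fix g assume g: "g \<in> carrier G"
  show "linear_map_on (topspace induced_topology) (translate g)"
    by (auto simp: linear_map_on_def translate_def fun_eq_iff scaleR_fun_def)
  show "continuous_map induced_topology induced_topology (translate g)"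
    by (rule translate_continuous[OF g])
  show "translate g ` induced_cone \<subseteq> induced_cone"
    using translate_mem[OF g] zero_C by (auto simp: induced_cone_def translate_def)
next
  fix f assume "f \<in> topspace induced_topology"
  then show "translate \<one> f = f"
    using induced_space_outside[of f] by (auto simp: topspace_induced_topology translate_def)
next
  fix g h f assume "g \<in> carrier G" "h \<in> carrier G"
  then show "translate (g \<otimes> h) f = translate g (translate h f)"
    by (auto simp: translate_def inv_mult_group m_assoc)
qed

lemma proper_cone_induced: "proper_cone induced_cone"
proof -
  have cc: "convex_cone C" "C \<inter> uminus ` C = {0}"
    using C by (auto simp: proper_cone_def)
  have "convex_cone induced_cone"
    using subspace_induced_space cc(1) unfolding convex_cone_iff induced_cone_def
    by (auto simp: subspace_def scaleR_fun_def)
  moreover have "f = 0" if f: "f \<in> induced_cone" "- f \<in> induced_cone" for f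
  proof
    fix x
    have "f x \<in> C" "- f x \<in> C"
      using f by (auto simp: induced_cone_def)
    then have "f x \<in> C \<inter> uminus ` C"
      by (auto intro: image_eqI[of _ _ "- f x"])
    then show "f x = 0 x"
      using cc(2) by auto
  qed
  ultimately show ?thesis
    using convex_cone_contains_0[of induced_cone] unfolding proper_cone_def
    by (auto intro: image_eqI[of _ _ 0])
qed

lemma induced_zero_neighbourhood:
  assumes "openin induced_topology W" "0 \<in> W"
  obtains S U where "finite S" "S \<subseteq> carrier G" "openin T U" "0 \<in> U"
    "\<And>f. f \<in> induced_space \<Longrightarrow> (\<And>x. x \<in> S \<Longrightarrow> f x \<in> U) \<Longrightarrow> f \<in> W"
proof -
  obtain W' where W': "openin (product_topology (\<lambda>_. T) UNIV) W'" "W = W' \<inter> induced_space"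
    using assms(1) by (auto simp: induced_topology_def openin_subtopology)
  then have "0 \<in> W'"
    using assms(2) by blast
  from W'(1) this lcs obtain S U where S: "finite S" "openin T U" "0 \<in> U"
    and W: "\<And>f. (\<And>i. f i \<in> topspace T) \<Longrightarrow> (\<And>i. i \<in> S \<Longrightarrow> f i \<in> U) \<Longrightarrow> f \<in> W'"
    by (rule product_topology_zero_neighbourhood) blast
  show ?thesis
  proof (rule that[of "S \<inter> carrier G" U])
    fix f assume f: "f \<in> induced_space" "\<And>x. x \<in> S \<inter> carrier G \<Longrightarrow> f x \<in> U"
    have "f x \<in> U" if "x \<in> S" for x
      using f that S(3) induced_space_outside[OF f(1), of x] by (cases "x \<in> carrier G") auto
    then show "f \<in> W"
      using W f(1) W'(2) by (auto simp: induced_space_mem)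
  qed (use S in auto)
qed

text \<open>
  The dual of a product is the direct sum of the duals: a functional is bounded on a neighbourhood
  that restricts only finitely many coordinates, so it vanishes on functions vanishing there.
\<close>

lemma induced_dual_decomposition:
  assumes \<mu>: "\<mu> \<in> topological_dual induced_topology"
  obtains R where "finite R" "R \<subseteq> carrier G" "\<And>r. r \<in> R \<Longrightarrow> coset_rep r = r"
    "\<And>f. f \<in> induced_space \<Longrightarrow> \<mu> f = (\<Sum>r\<in>R. \<mu> (inject r (f r)))"
proof -
  have lin: "linear_map_on induced_space \<mu>" and cont: "continuous_map induced_topology euclideanreal \<mu>"
    using \<mu> by (auto simp: topological_dual_def topspace_induced_topology)
  have "openin induced_topology {f \<in> topspace induced_topology. \<mu> f \<in> ball 0 1}"
    by (rule openin_continuous_map_preimage[OF cont]) simp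
  moreover have "0 \<in> {f \<in> topspace induced_topology. \<mu> f \<in> ball 0 1}"
    using linear_map_on_0[OF lin subspace_induced_space] subspace_0[OF subspace_induced_space]
    by (simp add: topspace_induced_topology)
  ultimately obtain S U where S: "finite S" "S \<subseteq> carrier G" "openin T U" "0 \<in> U"
    and small: "\<And>f. f \<in> induced_space \<Longrightarrow> (\<And>x. x \<in> S \<Longrightarrow> f x \<in> U) \<Longrightarrow>
      f \<in> {f \<in> topspace induced_topology. \<mu> f \<in> ball 0 1}"
    by (rule induced_zero_neighbourhood) blast
  have vanish: "\<mu> f = 0" if f: "f \<in> induced_space" "\<And>x. x \<in> S \<Longrightarrow> f x = 0" for f
  proof (rule ccontr)
    assume "\<mu> f \<noteq> 0"
    \<comment> \<open>All multiples of \<open>f\<close> vanish on \<open>S\<close> and hence stay in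
      the neighbourhood; this one has value \<open>1\<close> under \<open>\<mu>\<close>, violating
      the bound.\<close>
    define t where "t = 1 / \<mu> f"
    have "t *\<^sub>R f \<in> {f \<in> topspace induced_topology. \<mu> f \<in> ball 0 1}"
      using f S(4) by (intro small subspace_scale[OF subspace_induced_space]) (simp_all add: scaleR_fun_def)
    then have "\<bar>\<mu> (t *\<^sub>R f)\<bar> < 1"
      by simp
    then show False
      using linear_map_on_scaleR[OF lin f(1), of t] \<open>\<mu> f \<noteq> 0\<close> by (simp add: t_def)
  qed
  \<comment> \<open>Several points of \<open>S\<close> may share a coset; passing to representatives
    counts each coset once.\<close>
  define R where "R = coset_rep ` S"
  have R: "finite R" "R \<subseteq> carrier G"
    using S coset_rep(1) by (auto simp: R_def)
  have idem: "coset_rep r = r" if "r \<in> R" for r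
  proof -
    obtain s where s: "s \<in> carrier G" "r = coset_rep s"
      using \<open>r \<in> R\<close> S(2) by (auto simp: R_def)
    then show ?thesis
      using coset_rep_cong[OF s(1) coset_rep[OF s(1)]] by simp
  qed
  have "\<mu> f = (\<Sum>r\<in>R. \<mu> (inject r (f r)))" if f: "f \<in> induced_space" for f
  proof -
    have inj: "inject r (f r) \<in> induced_space" if "r \<in> R" for r
      using that R(2) by (intro inject_mem induced_space_mem[OF f]) auto
    have sum_mem: "(\<Sum>r\<in>R. inject r (f r)) \<in> induced_space"
      by (intro subspace_sum[OF subspace_induced_space] inj)
    have sum_apply: "(\<Sum>r\<in>A. inject r (f r)) s = (\<Sum>r\<in>A. inject r (f r) s)" for s and A :: "'a set"
      by (induction A rule: infinite_finite_induct) auto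
    have "(f - (\<Sum>r\<in>R. inject r (f r))) s = 0" if s: "s \<in> S" for s
    proof -
      have sG: "s \<in> carrier G"
        using s S(2) by blast
      \<comment> \<open>Distinct elements of \<open>R\<close> lie in distinct cosets, so at
        \<open>s\<close> exactly one summand survives, with value \<open>f s\<close>.\<close>
      have "inject r (f r) s = (if r = coset_rep s then f s else 0)" if r: "r \<in> R" for r
      proof (cases "r = coset_rep s")
        case True
        then show ?thesis
          using coset_rep[OF sG] sG by (simp add: inject_eval[OF f] same_coset_sym)
      next
        case False
        then have "\<not> same_coset r s"
          using coset_rep_cong[of r s] idem[OF r] r R(2) sG by auto
        then show ?thesis
          using False by (simp add: inject_def)
      qed
      then have "(\<Sum>r\<in>R. inject r (f r) s) = (\<Sum>r\<in>R. if r = coset_rep s then f s else 0)"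
        by (intro sum.cong) auto
      also have "\<dots> = f s"
        using R(1) s by (simp add: R_def)
      finally show ?thesis
        by (simp add: sum_apply)
    qed
    then have "\<mu> (f - (\<Sum>r\<in>R. inject r (f r))) = 0"
      using f sum_mem by (intro vanish subspace_diff[OF subspace_induced_space])
    then show ?thesis
      using linear_map_on_diff[OF lin subspace_induced_space f sum_mem]
        linear_map_on_sum[OF lin subspace_induced_space inj] by simp
  qed
  then show ?thesis
    using that R idem by blast
qed

text \<open>Weak completeness of \<open>C\<close> gives a limit in each coordinate. A functional on
  the induced space sees only finitely many representatives, so convergence there suffices.\<close>

lemma weakly_complete_induced:
  assumes wc: "weakly_complete T C"
  shows "weakly_complete induced_topology induced_cone"
  unfolding weakly_complete_iff[OF lcs_induced_topology induced_cone_subset]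
proof (intro allI impI, elim conjE)
  fix \<F> assume \<F>: "\<F> \<noteq> bot" "\<F> \<le> principal induced_cone"
    and conv: "\<forall>\<nu>\<in>topological_dual induced_topology. \<exists>l. (\<nu> \<longlongrightarrow> l) \<F>"
  have ev: "\<forall>\<^sub>F f in \<F>. f \<in> induced_cone"
    using \<F>(2) by (simp add: le_principal)
  have "\<exists>c\<in>C. \<forall>\<mu>\<in>topological_dual T. ((\<lambda>f. \<mu> (f r)) \<longlongrightarrow> \<mu> c) \<F>" for r
  proof -
    let ?\<F> = "filtermap (\<lambda>f. f r) \<F>"
    have "?\<F> \<noteq> bot"
      using \<F>(1) by (simp add: filtermap_bot_iff)
    moreover have "?\<F> \<le> principal C"
      using ev by (auto simp: le_principal eventually_filtermap induced_cone_def elim: eventually_mono)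
    moreover have "\<exists>l. (\<mu> \<longlongrightarrow> l) ?\<F>" if "\<mu> \<in> topological_dual T" for \<mu>
      using conv topological_dual_compose[OF that eval_linear eval_continuous, of r]
      unfolding filterlim_filtermap by blast
    ultimately have "\<exists>c\<in>C. \<forall>\<mu>\<in>topological_dual T. (\<mu> \<longlongrightarrow> \<mu> c) ?\<F>"
      using wc unfolding weakly_complete_iff[OF lcs C_subset] by blast
    then show ?thesis
      by (simp add: filterlim_filtermap)
  qed
  then obtain c where c: "\<And>r. c r \<in> C"
      "\<And>r \<mu>. \<mu> \<in> topological_dual T \<Longrightarrow> ((\<lambda>f. \<mu> (f r)) \<longlongrightarrow> \<mu> (c r)) \<F>"
    by metis
  \<comment> \<open>The coordinatewise limits \<open>c\<close> need not be equivariant; only those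
    at representatives are kept and spread over the cosets.\<close>
  define l where "l x = inject (coset_rep x) (c (coset_rep x)) x" for x
  have l: "l \<in> induced_cone"
    unfolding induced_cone_def induced_space_def
  proof (intro CollectI conjI allI ballI impI)
    show lC: "l x \<in> C" for x
      using inject_cone[OF coset_rep(1) c(1)] zero_C
      by (cases "x \<in> carrier G") (auto simp: l_def induced_cone_def, simp add: inject_def)
    show "l x \<in> topspace T" for x
      using lC C_subset by blast
    show "l x = 0" if "x \<notin> carrier G" for x
      using that by (simp add: l_def inject_def)
    fix x y assume xy: "x \<in> carrier G" "y \<in> carrier G" "same_coset y x"
    \<comment> \<open>Points of one coset share their representative, so on that coset
      \<open>l\<close> is a single injected function and inherits its equivariance.\<close>
    have "inject (coset_rep y) (c (coset_rep y)) \<in> induced_space"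
      using coset_rep(1)[OF xy(2)] c(1) C_subset by (intro inject_mem) auto
    then show "l x = \<pi> (inv x \<otimes> y) (l y)"
      using induced_space_equivariant xy coset_rep_cong[OF xy(2,1,3)] by (simp add: l_def)
  qed
  have "(\<nu> \<longlongrightarrow> \<nu> l) \<F>" if \<nu>: "\<nu> \<in> topological_dual induced_topology" for \<nu>
  proof -
    obtain R where R: "R \<subseteq> carrier G" "\<And>r. r \<in> R \<Longrightarrow> coset_rep r = r"
      and \<nu>_eq: "\<And>f. f \<in> induced_space \<Longrightarrow> \<nu> f = (\<Sum>r\<in>R. \<nu> (inject r (f r)))"
      using induced_dual_decomposition[OF \<nu>] by metis
    have "((\<lambda>f. \<Sum>r\<in>R. \<nu> (inject r (f r))) \<longlongrightarrow> (\<Sum>r\<in>R. \<nu> (inject r (c r)))) \<F>"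
      using R(1) by (intro tendsto_sum c(2) topological_dual_compose[OF \<nu>] inject_linear
          inject_continuous) auto
    \<comment> \<open>An element of \<open>R\<close> is its own representative, and there
      \<open>inject\<close> acts through the identity.\<close>
    moreover have "l r = c r" if "r \<in> R" for r
      using R that c(1)[of r] C_subset
      by (auto simp: l_def inject_def same_coset_refl rep_one subset_iff)
    then have "\<nu> l = (\<Sum>r\<in>R. \<nu> (inject r (c r)))"
      using l by (simp add: \<nu>_eq induced_cone_def)
    moreover have "\<forall>\<^sub>F f in \<F>. (\<Sum>r\<in>R. \<nu> (inject r (f r))) = \<nu> f"
      using ev by eventually_elim (simp add: \<nu>_eq induced_cone_def)
    ultimately show ?thesis
      using Lim_transform_eventually by metis
  qed
  then show "\<exists>c\<in>induced_cone. \<forall>\<nu>\<in>topological_dual induced_topology. (\<nu> \<longlongrightarrow> \<nu> c) \<F>"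
    using l by blast
qed

text \<open>Confines every coordinate of the \<open>G\<close>-orbit to the bounded
  \<open>H\<close>-orbit of \<open>x\<close> together with \<open>0\<close>, uniformly in
  \<open>g\<close>.\<close>

lemma inject_orbit_value:
  assumes "g \<in> carrier G" "s \<in> carrier G"
  shows "inject g x s = 0 \<or> (\<exists>h\<in>H. inject g x s = \<pi> h x)"
  using assms same_coset_mem[of s g] by (auto simp: inject_def)

text \<open>The coordinate of \<open>inject g x\<close> at \<open>s\<close> is governed by
  \<open>inv s \<otimes> g\<close>. Replacing \<open>g\<close> by \<open>a \<otimes> g\<close>
  multiplies this element on the left by the conjugate \<open>inv s \<otimes> a \<otimes> s\<close>,
  to which the uniform continuity over \<open>H\<close> applies.\<close>

lemma uniformly_continuous_induced:
  assumes G: "topological_group G TG" and H: "openin TG H"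
    and uc: "locally_bounded_right_uniformly_continuous (G\<lparr>carrier := H\<rparr>) (subtopology TG H) T C \<pi>"
  shows "locally_bounded_right_uniformly_continuous G TG induced_topology induced_cone translate"
proof -
  obtain x where x: "x \<in> C" "x \<noteq> 0" and bdd: "bounded_subset T ((\<lambda>h. \<pi> h x) ` H)"
    and unif: "\<And>U. openin T U \<Longrightarrow> 0 \<in> U \<Longrightarrow> \<exists>V. openin (subtopology TG H) V \<and> \<one> \<in> V \<and>
        (\<forall>a\<in>V. \<forall>h\<in>H. \<pi> (a \<otimes> h) x - \<pi> h x \<in> U)"
    using uc unfolding locally_bounded_right_uniformly_continuous_def by auto
  have tG: "topspace TG = carrier G"
    using G by (simp add: topological_group_def)
  have G_one: "\<one> \<in> carrier G"
    by (rule monoid.one_closed[OF monoid_axioms])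
  have xT: "x \<in> topspace T"
    using x(1) C_subset by blast
  have orbit: "translate g (inject \<one> x) = inject g x" if "g \<in> carrier G" for g
    using translate_inject[OF that G_one] that by simp
  have "bounded_subset induced_topology ((\<lambda>g. translate g (inject \<one> x)) ` carrier G)"
    unfolding bounded_subset_def
  proof (intro conjI allI impI)
    show "(\<lambda>g. translate g (inject \<one> x)) ` carrier G \<subseteq> topspace induced_topology"
      using inject_mem[OF _ xT] by (auto simp: orbit topspace_induced_topology)
  next
    fix W assume "openin induced_topology W \<and> 0 \<in> W"
    then obtain S U where S: "S \<subseteq> carrier G" "openin T U" "0 \<in> U"
      and W: "\<And>f. f \<in> induced_space \<Longrightarrow> (\<And>x. x \<in> S \<Longrightarrow> f x \<in> U) \<Longrightarrow> f \<in> W"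
      using induced_zero_neighbourhood by metis
    then obtain r where r: "r > 0" "\<And>t. \<bar>t\<bar> \<ge> r \<Longrightarrow> (\<lambda>h. \<pi> h x) ` H \<subseteq> (\<lambda>y. t *\<^sub>R y) ` U"
      using bdd unfolding bounded_subset_def by meson
    have "inject g x \<in> (\<lambda>f. t *\<^sub>R f) ` W" if t: "\<bar>t\<bar> \<ge> r" and g: "g \<in> carrier G" for t g
    proof -
      have t0: "t \<noteq> 0"
        using r(1) t by auto
      \<comment> \<open>Membership in \<open>W\<close> is decided by the coordinates in
        \<open>S\<close>, where the value is \<open>0\<close> or lies in the absorbed
        \<open>H\<close>-orbit.\<close>
      have "((1 / t) *\<^sub>R inject g x) s \<in> U" if s: "s \<in> S" for s
      proof -
        have "inject g x s = 0 \<or> inject g x s \<in> (\<lambda>y. t *\<^sub>R y) ` U"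
          using inject_orbit_value[OF g subsetD[OF S(1) s], of x] r(2)[OF t] by auto
        then show ?thesis
          using S(3) t0 by (auto simp: scaleR_fun_def)
      qed
      then have "(1 / t) *\<^sub>R inject g x \<in> W"
        using inject_mem[OF g xT] by (intro W subspace_scale[OF subspace_induced_space])
      then show ?thesis
        using t0 by (intro image_eqI[of _ _ "(1 / t) *\<^sub>R inject g x"]) simp_all
    qed
    then show "\<exists>r>0. \<forall>t. r \<le> \<bar>t\<bar> \<longrightarrow>
        (\<lambda>g. translate g (inject \<one> x)) ` carrier G \<subseteq> (\<lambda>f. t *\<^sub>R f) ` W"
      using r(1) orbit by (intro exI[of _ r]) auto
  qed
  moreover have "\<exists>V. openin TG V \<and> \<one> \<in> V \<and> (\<forall>a\<in>V. \<forall>g\<in>carrier G.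
      translate (a \<otimes> g) (inject \<one> x) - translate g (inject \<one> x) \<in> W)"
    if W0: "openin induced_topology W" "0 \<in> W" for W
  proof -
    obtain S U where S: "finite S" "S \<subseteq> carrier G" "openin T U" "0 \<in> U"
      and W: "\<And>f. f \<in> induced_space \<Longrightarrow> (\<And>x. x \<in> S \<Longrightarrow> f x \<in> U) \<Longrightarrow> f \<in> W"
      using induced_zero_neighbourhood[OF W0] by metis
    obtain V where V: "openin (subtopology TG H) V" "\<one> \<in> V"
        "\<And>a h. a \<in> V \<Longrightarrow> h \<in> H \<Longrightarrow> \<pi> (a \<otimes> h) x - \<pi> h x \<in> U"
      using unif[OF S(3,4)] by blast
    \<comment> \<open>Openness of \<open>H\<close> makes a neighbourhood of the identity in
      \<open>H\<close> one in \<open>G\<close>.\<close>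
    have VG: "openin TG V" and VH: "V \<subseteq> H"
      using V(1) H by (auto simp: openin_open_subtopology)
    \<comment> \<open>One condition per coordinate \<open>s\<close>; finiteness of \<open>S\<close>
      keeps their intersection open.\<close>
    define N where "N s = {a \<in> topspace TG. inv s \<otimes> a \<otimes> s \<in> V}" for s
    have "openin TG (N s)" if "s \<in> carrier G" for s
      unfolding N_def using that tG
      by (intro openin_continuous_map_preimage[OF _ VG] topological_group_continuous_mult[OF G]) auto
    then have "openin TG (topspace TG \<inter> \<Inter>(N ` S))"
      using S(1,2) by (cases "S = {}") (auto intro!: openin_Int openin_Inter)
    moreover have "\<one> \<in> topspace TG \<inter> \<Inter>(N ` S)"
      using S(2) V(2) tG G_one by (auto simp: N_def subset_iff)
    moreover have "translate (a \<otimes> g) (inject \<one> x) - translate g (inject \<one> x) \<in> W"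
      if a: "a \<in> topspace TG \<inter> \<Inter>(N ` S)" and g: "g \<in> carrier G" for a g
    proof -
      have aG: "a \<in> carrier G"
        using a tG by blast
      have "(inject (a \<otimes> g) x - inject g x) s \<in> U" if s: "s \<in> S" for s
      proof -
        have sG: "s \<in> carrier G"
          using s S(2) by blast
        define v where "v = inv s \<otimes> a \<otimes> s"
        have v: "v \<in> V" "v \<in> H"
          using a s VH by (auto simp: N_def v_def)
        have eq: "inv s \<otimes> (a \<otimes> g) = v \<otimes> (inv s \<otimes> g)"
          using sG aG g by (simp add: v_def m_assoc mult_inv_cancel)
        show ?thesis
        \<comment> \<open>Since \<open>v\<close> lies in \<open>H\<close>, the point
          \<open>s\<close> belongs to both cosets, of \<open>g\<close> and of
          \<open>a \<otimes> g\<close>, or to neither.\<close>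
        proof (cases "inv s \<otimes> g \<in> H")
          case True
          then have "same_coset s g" "same_coset s (a \<otimes> g)"
            using v by (simp_all add: same_coset_def eq)
          then have "same_coset g s" "same_coset (a \<otimes> g) s"
            using sG aG g by (simp_all add: same_coset_sym)
          then show ?thesis
            using V(3)[OF v(1) True] sG by (simp add: inject_def eq)
        next
          case False
          have "inv s \<otimes> (a \<otimes> g) \<notin> H"
          proof
            assume "inv s \<otimes> (a \<otimes> g) \<in> H"
            then have "inv v \<otimes> (v \<otimes> (inv s \<otimes> g)) \<in> H"
              using v(2) unfolding eq by simp
            then show False
              using False sG g v(2) subset by (simp add: mult_inv_cancel)
          qed
          then have "\<not> same_coset g s" "\<not> same_coset (a \<otimes> g) s"
            using False sG aG g same_coset_mem by auto
          then show ?thesis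
            using S(4) by (simp add: inject_def)
        qed
      qed
      then have "inject (a \<otimes> g) x - inject g x \<in> W"
        using aG g xT by (intro W subspace_diff[OF subspace_induced_space] inject_mem) auto
      then show ?thesis
        using aG g by (simp add: orbit)
    qed
    ultimately show ?thesis
      by blast
  qed
  moreover have "inject \<one> x \<one> = x"
    using xT by (simp add: inject_def same_coset_def rep_one)
  then have "inject \<one> x \<noteq> 0"
    using x(2) by auto
  ultimately show ?thesis
    unfolding locally_bounded_right_uniformly_continuous_def
    using inject_cone[OF G_one x(1)] by (intro bexI[of _ "inject \<one> x"]) auto
qed

lemma adjoint_translate:
  assumes "f \<in> induced_space" "k \<in> carrier G"
  shows "adjoint_rep G translate k (\<lambda>f. \<mu> (f \<one>)) f = \<mu> (f k)"
  using assms by (simp add: adjoint_rep_def translate_def monoid.one_closed[OF monoid_axioms])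

text \<open>The dominating functional is \<open>\<mu>\<close> evaluated at the identity. Its
  translates are the evaluations of \<open>\<mu>\<close> at arbitrary points of \<open>G\<close>,
  enough to dominate each of the finitely many coordinates on which \<open>\<nu>\<close>
  depends.\<close>

lemma cobounded_type_induced:
  assumes cb: "cobounded_type (G\<lparr>carrier := H\<rparr>) T C \<pi>"
  shows "cobounded_type G induced_topology induced_cone translate"
proof -
  obtain \<mu> where \<mu>: "\<mu> \<in> topological_dual T"
    and dom: "\<And>\<nu>. \<nu> \<in> topological_dual T \<Longrightarrow>
      \<exists>(n::nat) h. (\<forall>j\<in>{1..n}. h j \<in> H) \<and>
        dual_le C \<nu> (\<lambda>x. \<Sum>j=1..n. adjoint_rep (G\<lparr>carrier := H\<rparr>) \<pi> (h j) \<mu> x) \<and>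
        dual_le C (\<lambda>x. - \<nu> x) (\<lambda>x. \<Sum>j=1..n. adjoint_rep (G\<lparr>carrier := H\<rparr>) \<pi> (h j) \<mu> x)"
    using cb unfolding cobounded_type_def by auto
  let ?\<mu> = "\<lambda>f. \<mu> (f \<one>)"
  have "\<exists>(n::nat) g. (\<forall>j\<in>{1..n}. g j \<in> carrier G) \<and>
      dual_le induced_cone \<nu> (\<lambda>x. \<Sum>j=1..n. adjoint_rep G translate (g j) ?\<mu> x) \<and>
      dual_le induced_cone (\<lambda>x. - \<nu> x) (\<lambda>x. \<Sum>j=1..n. adjoint_rep G translate (g j) ?\<mu> x)"
    if \<nu>: "\<nu> \<in> topological_dual induced_topology" for \<nu>
  proof -
    obtain R where R: "finite R" "R \<subseteq> carrier G"
      and \<nu>_eq: "\<And>f. f \<in> induced_space \<Longrightarrow> \<nu> f = (\<Sum>r\<in>R. \<nu> (inject r (f r)))"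
      using induced_dual_decomposition[OF \<nu>] by metis
    \<comment> \<open>Both signs are merged into a bound on the absolute value, so that the triangle
      inequality can sum over \<open>R\<close>.\<close>
    have "\<exists>(n::nat) h. (\<forall>j\<in>{1..n}. h j \<in> H) \<and>
        (\<forall>c\<in>C. \<bar>\<nu> (inject r c)\<bar> \<le> (\<Sum>j=1..n. \<mu> (\<pi> (inv (h j)) c)))" if "r \<in> R" for r
    proof -
      have "(\<lambda>c. \<nu> (inject r c)) \<in> topological_dual T"
        using that R(2) by (intro topological_dual_compose[OF \<nu>] inject_linear inject_continuous) auto
      then obtain n :: nat and h where h: "\<forall>j\<in>{1..n}. h j \<in> H"
        "dual_le C (\<lambda>c. \<nu> (inject r c)) (\<lambda>x. \<Sum>j=1..n. adjoint_rep (G\<lparr>carrier := H\<rparr>) \<pi> (h j) \<mu> x)"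
        "dual_le C (\<lambda>c. - \<nu> (inject r c)) (\<lambda>x. \<Sum>j=1..n. adjoint_rep (G\<lparr>carrier := H\<rparr>) \<pi> (h j) \<mu> x)"
        using dom by blast
      have "(\<Sum>j=1..n. adjoint_rep (G\<lparr>carrier := H\<rparr>) \<pi> (h j) \<mu> c) =
          (\<Sum>j=1..n. \<mu> (\<pi> (inv (h j)) c))" for c
        using h(1) by (intro sum.cong refl) (simp add: adjoint_rep_def m_inv_consistent[OF subgroup_axioms])
      then show ?thesis
        using h by (intro exI[of _ n] exI[of _ h]) (auto simp: dual_le_def abs_le_iff)
    qed
    then obtain n :: "'a \<Rightarrow> nat" and h where
      h: "\<And>r j. r \<in> R \<Longrightarrow> j \<in> {1..n r} \<Longrightarrow> h r j \<in> H"
        "\<And>r c. r \<in> R \<Longrightarrow> c \<in> C \<Longrightarrow> \<bar>\<nu> (inject r c)\<bar> \<le> (\<Sum>j=1..n r. \<mu> (\<pi> (inv (h r j)) c))"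
      by metis
    \<comment> \<open>The number of translates varies with \<open>r\<close>; the pairs are collected
      and then enumerated, since the definition asks for a family indexed by
      \<open>{1..n}\<close>.\<close>
    define I where "I = (SIGMA r:R. {1..n r})"
    have "finite I"
      using R(1) by (simp add: I_def)
    then obtain b where b: "bij_betw b {1..card I} I"
      using ex_bij_betw_nat_finite_1 by blast
    define k where "k i = (case i of (r, j) \<Rightarrow> r \<otimes> h r j)" for i
    have k: "k i \<in> carrier G" if "i \<in> I" for i
      using that R(2) h(1) subset by (auto simp: I_def k_def)
    have bI: "b i \<in> I" if "i \<in> {1..card I}" for i
      using b that by (auto simp: bij_betw_def)
    have bound: "\<bar>\<nu> f\<bar> \<le> (\<Sum>i=1..card I. adjoint_rep G translate (k (b i)) ?\<mu> f)"
      if f: "f \<in> induced_cone" for f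
    proof -
      have fI: "f \<in> induced_space" and fC: "\<And>x. f x \<in> C"
        using f by (auto simp: induced_cone_def)
      have "\<bar>\<nu> f\<bar> \<le> (\<Sum>r\<in>R. \<bar>\<nu> (inject r (f r))\<bar>)"
        unfolding \<nu>_eq[OF fI] by (rule sum_abs)
      also have "\<dots> \<le> (\<Sum>r\<in>R. \<Sum>j=1..n r. \<mu> (\<pi> (inv (h r j)) (f r)))"
        by (intro sum_mono h(2) fC)
      also have "\<dots> = (\<Sum>r\<in>R. \<Sum>j=1..n r. \<mu> (f (r \<otimes> h r j)))"
      proof (intro sum.cong refl)
        fix r j assume r: "r \<in> R" "j \<in> {1..n r}"
        have hr: "h r j \<in> H" "h r j \<in> carrier G" "r \<in> carrier G"
          using h(1)[OF r] r(1) R(2) subset by auto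
        \<comment> \<open>Equivariance turns the action of \<open>H\<close> on the value at
          \<open>r\<close> into a shift of the evaluation point within its coset.\<close>
        have "f (r \<otimes> h r j) = \<pi> (inv (r \<otimes> h r j) \<otimes> r) (f r)"
          using hr by (intro induced_space_equivariant[OF fI]) (simp_all add: same_coset_def mult_inv_cancel)
        moreover have "inv (r \<otimes> h r j) \<otimes> r = inv (h r j)"
          using hr by (simp add: inv_mult_group m_assoc)
        ultimately show "\<mu> (\<pi> (inv (h r j)) (f r)) = \<mu> (f (r \<otimes> h r j))"
          by simp
      qed
      also have "\<dots> = (\<Sum>i\<in>I. \<mu> (f (k i)))"
        unfolding I_def k_def using R(1) by (subst sum.Sigma) (auto intro!: sum.cong)
      also have "\<dots> = (\<Sum>i=1..card I. \<mu> (f (k (b i))))"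
        by (rule sum.reindex_bij_betw[OF b, symmetric])
      also have "\<dots> = (\<Sum>i=1..card I. adjoint_rep G translate (k (b i)) ?\<mu> f)"
        using k bI by (intro sum.cong refl) (simp add: adjoint_translate[OF fI])
      finally show ?thesis .
    qed
    show ?thesis
    proof (intro exI conjI ballI)
      show "k (b i) \<in> carrier G" if "i \<in> {1..card I}" for i
        using k bI[OF that] .
      show "dual_le induced_cone \<nu> (\<lambda>x. \<Sum>i=1..card I. adjoint_rep G translate (k (b i)) ?\<mu> x)"
        "dual_le induced_cone (\<lambda>x. - \<nu> x) (\<lambda>x. \<Sum>i=1..card I. adjoint_rep G translate (k (b i)) ?\<mu> x)"
        using bound by (auto simp: dual_le_def abs_le_iff)
    qed
  qed
  moreover have "?\<mu> \<in> topological_dual induced_topology"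
    by (rule topological_dual_compose[OF \<mu> eval_linear eval_continuous])
  ultimately show ?thesis
    unfolding cobounded_type_def by blast
qed

text \<open>A translation-invariant function is constant on \<open>G\<close>, and equivariance
  forces the constant to be fixed by \<open>H\<close>. It is non-zero because \<open>f\<close>
  vanishes off the carrier.\<close>

lemma translate_fixed_point:
  assumes f: "f \<in> induced_cone" "f \<noteq> 0" and fixed: "\<And>g. g \<in> carrier G \<Longrightarrow> translate g f = f"
  shows "f \<one> \<in> C" "f \<one> \<noteq> 0" "h \<in> H \<Longrightarrow> \<pi> h (f \<one>) = f \<one>"
proof -
  have fI: "f \<in> induced_space"
    using f(1) by (simp add: induced_cone_def)
  show "f \<one> \<in> C"
    using f(1) by (simp add: induced_cone_def)
  have const: "f x = f \<one>" if "x \<in> carrier G" for x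
    using fun_cong[OF fixed[OF that], of x] that by (simp add: translate_def)
  show "f \<one> \<noteq> 0"
  proof
    assume "f \<one> = 0"
    then have "f x = 0" for x
      using const[of x] induced_space_outside[OF fI, of x] by metis
    then show False
      using f(2) by (simp add: fun_eq_iff)
  qed
  show "\<pi> h (f \<one>) = f \<one>" if h: "h \<in> H"
  proof -
    have hG: "h \<in> carrier G"
      using h subset by blast
    \<comment> \<open>The point \<open>inv h\<close> is chosen because equivariance relates it to
      the identity through \<open>h\<close> itself.\<close>
    then have "f (inv h) = \<pi> (inv (inv h) \<otimes> \<one>) (f \<one>)"
      using h by (intro induced_space_equivariant[OF fI])
        (simp_all add: same_coset_def monoid.one_closed[OF monoid_axioms])
    then show ?thesis
      using hG const[of "inv h"] by simp
  qed
qed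

end

text \<open>The property of \<open>G\<close> is assumed at the type of functions from the group to
  \<open>'e\<close>, since the induced space is a subspace of that type.\<close>

lemma fixed_point_property_for_cones_open_subgroup:
  fixes G :: "'g monoid"
  assumes G: "topological_group G TG" and H: "subgroup H G" "openin TG H"
    and fpp: "fixed_point_property_for_cones TYPE('g \<Rightarrow> 'e::real_vector) G TG"
  shows "fixed_point_property_for_cones TYPE('e) (G\<lparr>carrier := H\<rparr>) (subtopology TG H)"
  unfolding fixed_point_property_for_cones_def
proof (intro allI impI, elim conjE)
  fix T :: "'e topology" and C \<pi>
  assume T: "locally_convex_space T" and CT: "C \<subseteq> topspace T" and C: "proper_cone C"
    and wc: "weakly_complete T C" and rep: "cone_representation (G\<lparr>carrier := H\<rparr>) T C \<pi>"
    and uc: "locally_bounded_right_uniformly_continuous (G\<lparr>carrier := H\<rparr>) (subtopology TG H) T C \<pi>"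
    and cb: "cobounded_type (G\<lparr>carrier := H\<rparr>) T C \<pi>"
  have grp: "group G"
    using G by (simp add: topological_group_def)
  interpret induced_rep G H T C \<pi>
    by (intro induced_rep.intro cone_rep.intro induced_rep_axioms.intro grp H(1) T CT rep C)
  obtain f where f: "f \<in> induced_cone" "f \<noteq> 0" "\<forall>g\<in>carrier G. translate g f = f"
    by (rule fixed_point_property_for_conesD[OF fpp lcs_induced_topology induced_cone_subset
          proper_cone_induced weakly_complete_induced[OF wc] cone_representation_induced
          uniformly_continuous_induced[OF G H(2) uc] cobounded_type_induced[OF cb]])
  then show "\<exists>x\<in>C. x \<noteq> 0 \<and> (\<forall>h\<in>carrier (G\<lparr>carrier := H\<rparr>). \<pi> h x = x)"
    using translate_fixed_point[OF f(1,2)] by (intro bexI[of _ "f \<one>\<^bsub>G\<^esub>"]) auto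
qed

theorem theorem9:
  shows
    "(\<forall>(G :: 'g monoid) TG H.
        topological_group G TG \<and>
        fixed_point_property_for_cones TYPE('g \<Rightarrow> 'e::real_vector) G TG \<and>
        subgroup H G \<and> openin TG H \<longrightarrow>
        fixed_point_property_for_cones TYPE('e) (G\<lparr>carrier := H\<rparr>) (subtopology TG H)) \<and>
     (\<forall>(H :: 'h monoid) TH (G :: 'g monoid) TG \<phi>.
        topological_group H TH \<and> topological_group G TG \<and>
        \<phi> \<in> hom H G \<and> continuous_map TH TG \<phi> \<and> \<phi> ` carrier H = carrier G \<and>
        fixed_point_property_for_cones TYPE('e) H TH \<longrightarrow>
        fixed_point_property_for_cones TYPE('e) G TG) \<and>
     (\<forall>(G :: 'g monoid) TG F.
        topological_group G TG \<and> F \<lhd> G \<and> finite F \<and>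
        fixed_point_property_for_cones TYPE('e) (G Mod F) (quotient_group_topology G TG F) \<longrightarrow>
        fixed_point_property_for_cones TYPE('e) G TG)"
  by (intro conjI allI impI; elim conjE)
    (rule fixed_point_property_for_cones_open_subgroup
      fixed_point_property_for_cones_surjective_image
      fixed_point_property_for_cones_finite_extension; assumption)+

end
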